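(* Let $n$ be an integer with prime decomposition $n = p_1^{y_1}\cdots p_r^{y_r}$ (the $p_i$ pairwise distinct primes, $y_i>0$) with $r\ge 2$, let $m=\gcd(p_1^{y_1}-1,\dots,p_r^{y_r}-1)$, and let $c\ge 1$. Let $M=(a_{ij})_{ij}\in GL_r(\mathbb{Z})$. Then there is an automorphism $\varphi$ of $\Gamma_{n,c}$ such that $\overline{\varphi}=M$ if and only if, for every $1\le i\le r$, $$p_1^{a_{1i}y_1}p_2^{a_{2i}y_2}\cdots p_r^{a_{ri}y_r}\equiv p_i^{y_i}\pmod{m^c}.$$
   Context: The group $\Gamma_n$ is $$\Gamma_n=\left\langle a,t_1,\dots,t_r \ \middle|\ t_it_j=t_jt_i\ (i\neq j),\ t_i a t_i^{-1}=a^{p_i^{y_i}}\ (1\le i\le r)\right\rangle,$$ and $\Gamma_{n,c}=\Gamma_n/\gamma_{c+1}(\Gamma_n)$, where $\gamma_1(G)=G$, $\gamma_{k+1}(G)=[\gamma_k(G),G]$. The group $\Gamma_{n,c}$ is identified with the semidirect product $\mathbb{Z}_{m^c}\rtimes\mathbb{Z}^r=\langle x\rangle\rtimes\langle s_1,\dots,s_r\rangle$, where $\langle x\rangle$ is cyclic of order $m^c$, $\langle s_1,\dots,s_r\rangle$ is free abelian on the $s_i$, and $s_ixs_i^{-1}=x^{p_i^{y_i}}$; under this identification $x$ and $s_i$ are the images of $a$ and $t_i$. The torsion subgroup $\tau\Gamma_{n,c}$ (the set of elements of finite order) is $\langle x\rangle$, and $\Gamma_{n,c}/\tau\Gamma_{n,c}=\mathbb{Z}^r$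 with basis the images of the $s_i$. Any $\varphi\in \mathrm{Aut}(\Gamma_{n,c})$ satisfies $\varphi(\tau\Gamma_{n,c})\subset\tau\Gamma_{n,c}$ and so induces an automorphism $\overline{\varphi}$ of $\mathbb{Z}^r=\Gamma_{n,c}/\tau\Gamma_{n,c}$. It is identified with the matrix $\overline{\varphi}=(a_{ij})_{ij}\in GL_r(\mathbb{Z})$ defined by $\overline{\varphi}(s_i)=s_1^{a_{1i}}\cdots s_r^{a_{ri}}$ (the $i$-th column gives the image of $s_i$). Since $\gcd(p_i^{y_i},m^c)=1$, each $p_i^{y_i}$ is invertible in the ring $\mathbb{Z}/m^c\mathbb{Z}$; for negative integers $k$, $p_i^{ky_i}$ modulo $m^c$ denotes the corresponding power of its inverse in $\mathbb{Z}/m^c\mathbb{Z}$, not a rational number. *)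

theory Defs
  imports
    "HOL-Analysis.Analysis"
    "HOL-Algebra.Algebra"
    "HOL-Number_Theory.Number_Theory"
begin

hide_const (open) Divisibility.prime

section \<open>Groups given by generators and relations\<close>

text \<open>
  A word is a list of letters; the letter \<open>(g, True)\<close> stands for the generator \<open>g\<close> and
  \<open>(g, False)\<close> for its inverse.  The generators are all elements of the type \<open>'g\<close>, and a
  pair \<open>(l, r)\<close> in \<open>R\<close> is the relation \<open>l = r\<close>.
\<close>

type_synonym 'g word = "('g \<times> bool) list"

inductive word_eq :: "('g word \<times> 'g word) set \<Rightarrow> 'g word \<Rightarrow> 'g word \<Rightarrow> bool"
  for R :: "('g word \<times> 'g word) set" where
  refl: "word_eq R u u"
| sym: "word_eq R u v \<Longrightarrow> word_eq R v u"
| trans: "word_eq R u v \<Longrightarrow> word_eq R v w \<Longrightarrow> word_eq R u w"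
| cancel: "word_eq R (u @ [(g, b), (g, \<not> b)] @ v) (u @ v)"
| relation: "(l, r) \<in> R \<Longrightarrow> word_eq R (u @ l @ v) (u @ r @ v)"

definition word_class :: "('g word \<times> 'g word) set \<Rightarrow> 'g word \<Rightarrow> 'g word set" where
  "word_class R w = {v. word_eq R w v}"

definition presented_group :: "('g word \<times> 'g word) set \<Rightarrow> 'g word set monoid" where
  "presented_group R =
    \<lparr>carrier = range (word_class R),
     mult = (\<lambda>U V. \<Union>u\<in>U. \<Union>v\<in>V. word_class R (u @ v)),
     one = word_class R []\<rparr>"


section \<open>Lower central series and torsion\<close>

definition commutator_subgroup :: "('a, 'b) monoid_scheme \<Rightarrow> 'a set \<Rightarrow> 'a set \<Rightarrow> 'a set" where
  "commutator_subgroup G H K =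
    generate G {h \<otimes>\<^bsub>G\<^esub> k \<otimes>\<^bsub>G\<^esub> inv\<^bsub>G\<^esub> h \<otimes>\<^bsub>G\<^esub> inv\<^bsub>G\<^esub> k | h k. h \<in> H \<and> k \<in> K}"

text \<open>The series starts at index 1; the value at 0 is a dummy.\<close>

fun lower_central :: "('a, 'b) monoid_scheme \<Rightarrow> nat \<Rightarrow> 'a set" where
  "lower_central G 0 = carrier G"
| "lower_central G (Suc 0) = carrier G"
| "lower_central G (Suc (Suc k)) =
    commutator_subgroup G (lower_central G (Suc k)) (carrier G)"

definition torsion :: "('a, 'b) monoid_scheme \<Rightarrow> 'a set" where
  "torsion G = {g \<in> carrier G. \<exists>k::nat. k > 0 \<and> g [^]\<^bsub>G\<^esub> k = \<one>\<^bsub>G\<^esub>}"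


section \<open>Induced maps and their matrices\<close>

text \<open>
  For a normal subgroup \<open>N\<close> and an endomorphism \<open>\<phi>\<close> with \<open>\<phi>(N) \<subseteq> N\<close>, this is the map
  \<open>gN \<mapsto> \<phi>(g)N\<close> on \<open>G Mod N\<close>: all \<open>g\<close> in one coset give the same value.
\<close>

definition induced :: "('a, 'b) monoid_scheme \<Rightarrow> 'a set \<Rightarrow> ('a \<Rightarrow> 'a) \<Rightarrow> 'a set \<Rightarrow> 'a set" where
  "induced G N \<phi> C = the_elem ((\<lambda>g. N #>\<^bsub>G\<^esub> \<phi> g) ` C)"

text \<open>The \<open>i\<close>-th column holds the exponents of the image of the \<open>i\<close>-th basis element.\<close>

definition has_matrix ::
  "('a, 'b) monoid_scheme \<Rightarrow> ('r::finite \<Rightarrow> 'a) \<Rightarrow> ('a \<Rightarrow> 'a) \<Rightarrow> int^'r^'r \<Rightarrow> bool" where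
  "has_matrix Q e \<psi> M \<longleftrightarrow>
    (\<forall>i. \<psi> (e i) = finprod Q (\<lambda>j. e j [^]\<^bsub>Q\<^esub> (M $ j $ i)) UNIV)"


section \<open>The groups under consideration\<close>

text \<open>The primes are indexed by a finite type \<open>'r\<close>, so the number of primes is \<open>CARD('r)\<close>.\<close>

datatype 'r gen = Gen_a | Gen_t 'r

definition Gamma_rels :: "('r \<Rightarrow> nat) \<Rightarrow> ('r \<Rightarrow> nat) \<Rightarrow> ('r gen word \<times> 'r gen word) set" where
  "Gamma_rels p y =
    {([(Gen_t i, True), (Gen_t j, True)], [(Gen_t j, True), (Gen_t i, True)]) | i j. i \<noteq> j} \<union>
    {([(Gen_t i, True), (Gen_a, True), (Gen_t i, False)],
      replicate (p i ^ y i) (Gen_a, True)) | i. True}"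

definition Gamma :: "('r \<Rightarrow> nat) \<Rightarrow> ('r \<Rightarrow> nat) \<Rightarrow> 'r gen word set monoid" where
  "Gamma p y = presented_group (Gamma_rels p y)"

definition Gamma_nil ::
  "('r \<Rightarrow> nat) \<Rightarrow> ('r \<Rightarrow> nat) \<Rightarrow> nat \<Rightarrow> 'r gen word set set monoid" where
  "Gamma_nil p y c = Gamma p y Mod lower_central (Gamma p y) (c + 1)"

definition Gamma_nil_s ::
  "('r \<Rightarrow> nat) \<Rightarrow> ('r \<Rightarrow> nat) \<Rightarrow> nat \<Rightarrow> 'r \<Rightarrow> 'r gen word set set" where
  "Gamma_nil_s p y c i =
    lower_central (Gamma p y) (c + 1)
      #>\<^bsub>Gamma p y\<^esub> word_class (Gamma_rels p y) [(Gen_t i, True)]"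

definition induces_matrix ::
  "('r::finite \<Rightarrow> nat) \<Rightarrow> ('r \<Rightarrow> nat) \<Rightarrow> nat \<Rightarrow>
    ('r gen word set set \<Rightarrow> 'r gen word set set) \<Rightarrow> int^'r^'r \<Rightarrow> bool" where
  "induces_matrix p y c \<phi> M \<longleftrightarrow>
    (let G = Gamma_nil p y c; N = torsion G
     in has_matrix (G Mod N) (\<lambda>i. N #>\<^bsub>G\<^esub> Gamma_nil_s p y c i) (induced G N \<phi>) M)"


section \<open>Integer powers modulo an integer\<close>

text \<open>Meaningful for \<open>b\<close> coprime to \<open>k\<close>, where \<open>modular_inverse k b\<close> inverts \<open>b\<close> modulo \<open>k\<close>.\<close>

definition mod_powi :: "int \<Rightarrow> int \<Rightarrow> int \<Rightarrow> int" where
  "mod_powi k b e =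
    (if e \<ge> 0 then b ^ nat e mod k else modular_inverse k b ^ nat (- e) mod k)"

end

theory Submission
  imports Defs
begin

text \<open>
  Write \<open>q\<^sub>i\<close> for \<open>p\<^sub>i ^ y\<^sub>i\<close>, \<open>N = m ^ c\<close>, and \<open>x\<close>, \<open>s\<^sub>i\<close> for the images of \<open>a\<close>, \<open>t\<^sub>i\<close> in the
  nilpotent quotient \<open>G\<close> of \<open>Gamma\<close>.  Everything rests on one character: sending \<open>s\<^sub>i\<close> to \<open>q\<^sub>i\<close> and
  \<open>x\<close> to \<open>1\<close> gives a homomorphism \<open>chi\<close> from \<open>G\<close> to the units modulo \<open>N\<close> that depends only on
  the exponents \<open>\<sigma>\<^sub>i(g)\<close> of the \<open>s\<^sub>i\<close> in \<open>g\<close>, and \<open>g x g\<^sup>-\<^sup>1 = x ^ chi(\<sigma>(g))\<close> for all \<open>g\<close>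
  (lemma \<open>conj_x\<close>).  The congruence in the theorem says that \<open>chi\<close> takes the same value on the
  \<open>i\<close>-th column of \<open>M\<close> as on the \<open>i\<close>-th unit vector.

  It is necessary: an automorphism \<open>\<phi>\<close> preserves the torsion subgroup \<open>\<langle>x\<rangle>\<close>, and applying it to
  \<open>s\<^sub>i x s\<^sub>i\<^sup>-\<^sup>1 = x ^ q\<^sub>i\<close> shows that \<open>\<phi>(x)\<close> has equal powers with exponents \<open>q\<^sub>i\<close> and \<open>chi\<close> of
  the \<open>i\<close>-th column; as \<open>\<phi>\<close> is injective and \<open>x\<close> has order \<open>N\<close>, these exponents agree modulo \<open>N\<close>.
  It is sufficient: choose commuting elements \<open>s'\<^sub>i\<close> in the span of the \<open>s\<^sub>j\<close> whose exponents are
  the columns of \<open>M\<close>.  The congruence makes \<open>x\<close> and the \<open>s'\<^sub>i\<close> satisfy the defining relations, so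
  they are the images of \<open>x\<close> and the \<open>s\<^sub>i\<close> under an endomorphism.  It acts as the
  identity on \<open>\<langle>x\<rangle>\<close> and as the invertible matrix \<open>M\<close> on the quotient, hence is bijective.

  This argument uses only a few properties of \<open>G\<close>, collected in the locale
  \<open>cyclic_by_free_abelian\<close>.  That the nilpotent quotient has them follows from its universal property
  among groups of nilpotency class at most \<open>c\<close> (lemma \<open>Gamma_nil_universal\<close>), applied to three
  targets: the integers, to obtain the exponents \<open>\<sigma>\<^sub>i\<close>; a group of affine maps modulo \<open>N\<close>, to see that
  the order of \<open>x\<close> is a multiple of \<open>N\<close>; and \<open>G\<close> itself, to obtain endomorphisms.  That
  \<open>x ^ N = 1\<close> holds because commutation with the \<open>t\<^sub>i\<close> raises \<open>a ^ m ^ k\<close> to the powers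
  \<open>q\<^sub>i - 1\<close>, whose greatest common divisor is \<open>m\<close> (lemma \<open>Gamma_pow_lower_central\<close>).
\<close>

section \<open>Presented groups\<close>

lemma word_eq_context: "word_eq R u v \<Longrightarrow> word_eq R (w @ u @ z) (w @ v @ z)"
proof (induction rule: word_eq.induct)
  case (cancel u g b v)
  show ?case using word_eq.cancel[of R "w @ u" g b "v @ z"] by simp
next
  case (relation l r u v)
  then show ?case using word_eq.relation[of l r R "w @ u" "v @ z"] by simp
qed (blast intro: word_eq.intros)+

lemma word_eq_append:
  assumes "word_eq R u u'" "word_eq R v v'"
  shows "word_eq R (u @ v) (u' @ v')"
  using word_eq_context[OF assms(1), of "[]" v] word_eq_context[OF assms(2), of u' "[]"]
  by (auto intro: word_eq.trans)

lemma word_class_eq_iff: "word_class R u = word_class R v \<longleftrightarrow> word_eq R u v"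
  unfolding word_class_def by (blast intro: word_eq.intros)

lemma carrier_presented_group [simp]: "carrier (presented_group R) = range (word_class R)"
  by (simp add: presented_group_def)

lemma one_presented_group: "\<one>\<^bsub>presented_group R\<^esub> = word_class R []"
  by (simp add: presented_group_def)

lemma mult_presented_group:
  "word_class R u \<otimes>\<^bsub>presented_group R\<^esub> word_class R v = word_class R (u @ v)"
proof -
  have "word_class R (u' @ v') = word_class R (u @ v)"
    if "u' \<in> word_class R u" "v' \<in> word_class R v" for u' v'
    using that unfolding word_class_eq_iff
    by (auto simp: word_class_def intro: word_eq_append word_eq.sym)
  moreover have "u \<in> word_class R u" "v \<in> word_class R v"
    by (auto simp: word_class_def word_eq.refl)
  ultimately have "(\<Union>u'\<in>word_class R u. \<Union>v'\<in>word_class R v. word_class R (u' @ v')) = word_class R (u @ v)"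
    by blast
  then show ?thesis by (simp add: presented_group_def)
qed

lemma group_presented_group: "group (presented_group R)"
proof (rule groupI)
  fix U assume "U \<in> carrier (presented_group R)"
  then obtain w where U: "U = word_class R w" by auto
  have "word_eq R (map (\<lambda>(g, b). (g, \<not> b)) (rev w) @ w) []"
  proof (induction w)
    case (Cons l w)
    obtain g b where l: "l = (g, b)" by force
    have "word_eq R (map (\<lambda>(g, b). (g, \<not> b)) (rev w) @ [(g, \<not> b), (g, \<not> \<not> b)] @ w)
      (map (\<lambda>(g, b). (g, \<not> b)) (rev w) @ w)"
      by (rule word_eq.cancel)
    with Cons show ?case by (auto simp: l intro: word_eq.trans)
  qed (simp add: word_eq.refl)
  then show "\<exists>V\<in>carrier (presented_group R). V \<otimes>\<^bsub>presented_group R\<^esub> U = \<one>\<^bsub>presented_group R\<^esub>"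
    by (auto simp: U one_presented_group mult_presented_group word_class_eq_iff)
qed (auto simp: one_presented_group mult_presented_group)

fun word_eval :: "('a, 'b) monoid_scheme \<Rightarrow> ('g \<Rightarrow> 'a) \<Rightarrow> 'g word \<Rightarrow> 'a" where
  "word_eval H f [] = \<one>\<^bsub>H\<^esub>"
| "word_eval H f ((g, b) # w) = (if b then f g else inv\<^bsub>H\<^esub> f g) \<otimes>\<^bsub>H\<^esub> word_eval H f w"

context group
begin

lemma word_eval_closed: "range f \<subseteq> carrier G \<Longrightarrow> word_eval G f w \<in> carrier G"
  by (induction w) (auto simp: image_subset_iff)

lemma word_eval_append:
  assumes "range f \<subseteq> carrier G"
  shows "word_eval G f (u @ v) = word_eval G f u \<otimes> word_eval G f v"
proof (induction u)
  case (Cons l u)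
  have "f (fst l) \<in> carrier G" using assms by auto
  then show ?case
    using Cons word_eval_closed[OF assms] by (cases l) (auto simp: m_assoc)
qed (simp add: word_eval_closed[OF assms])

lemma word_eval_replicate:
  assumes "range f \<subseteq> carrier G"
  shows "word_eval G f (replicate k (g, True)) = f g [^] k"
proof -
  have "f g \<in> carrier G" using assms by auto
  then show ?thesis by (induction k) (auto simp: group_commutes_pow)
qed

lemma word_eval_cong:
  assumes f: "range f \<subseteq> carrier G"
    and rels: "\<And>l r. (l, r) \<in> R \<Longrightarrow> word_eval G f l = word_eval G f r"
    and "word_eq R u v"
  shows "word_eval G f u = word_eval G f v"
  using \<open>word_eq R u v\<close>
proof (induction rule: word_eq.induct)
  case (cancel u g b v)
  have "f g \<in> carrier G" using f by auto
  then show ?case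
    using word_eval_closed[OF f, of v] by (auto simp: word_eval_append[OF f] simp flip: m_assoc)
next
  case (relation l r u v)
  then show ?case by (simp add: word_eval_append[OF f] rels)
qed auto

lemma presented_group_universal:
  assumes f: "range f \<subseteq> carrier G"
    and rels: "\<And>l r. (l, r) \<in> R \<Longrightarrow> word_eval G f l = word_eval G f r"
  obtains h where "h \<in> hom (presented_group R) G"
    "\<And>w. h (word_class R w) = word_eval G f w"
proof -
  define h where "h U = word_eval G f (SOME w. U = word_class R w)" for U
  have h: "h (word_class R w) = word_eval G f w" for w
  proof -
    have "word_class R w = word_class R (SOME v. word_class R w = word_class R v)"
      by (rule someI_ex) blast
    then have "word_eq R w (SOME v. word_class R w = word_class R v)"
      by (simp only: word_class_eq_iff)
    then show ?thesis unfolding h_def using word_eval_cong[OF f rels] by metis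
  qed
  have "h \<in> hom (presented_group R) G"
    by (rule homI) (auto simp: h mult_presented_group word_eval_append[OF f] word_eval_closed[OF f])
  with h that show ?thesis by blast
qed

end

lemma inv_presented_group_letter:
  "inv\<^bsub>presented_group R\<^esub> (word_class R [(g, b)]) = word_class R [(g, \<not> b)]"
proof -
  interpret P: group "presented_group R" by (rule group_presented_group)
  have "word_eq R [(g, \<not> b), (g, b)] []"
    using word_eq.cancel[of R "[]" g "\<not> b" "[]"] by simp
  then show ?thesis
    by (intro P.inv_equality) (auto simp: mult_presented_group one_presented_group word_class_eq_iff)
qed

lemma word_class_eq_eval:
  "word_class R w = word_eval (presented_group R) (\<lambda>g. word_class R [(g, True)]) w"
proof (induction w)
  case (Cons l w)
  obtain g b where l: "l = (g, b)" by force
  have "word_class R (l # w) = word_class R [l] \<otimes>\<^bsub>presented_group R\<^esub> word_class R w"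
    by (simp add: mult_presented_group)
  also have "\<dots> = word_eval (presented_group R) (\<lambda>g. word_class R [(g, True)]) (l # w)"
    using Cons inv_presented_group_letter[of R g True] by (cases b) (auto simp: l)
  finally show ?case .
qed (simp add: one_presented_group)

lemma presented_group_relation:
  assumes "(l, r) \<in> R"
  shows "word_eval (presented_group R) (\<lambda>g. word_class R [(g, True)]) l =
    word_eval (presented_group R) (\<lambda>g. word_class R [(g, True)]) r"
proof -
  have "word_class R l = word_class R r"
    using word_eq.relation[OF assms, of "[]" "[]"] by (simp add: word_class_eq_iff)
  then show ?thesis by (metis word_class_eq_eval)
qed

lemma presented_group_generated:
  assumes K: "subgroup K (presented_group R)"
    and gens: "\<And>g. word_class R [(g, True)] \<in> K"
  shows "K = carrier (presented_group R)"
proof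
  show "K \<subseteq> carrier (presented_group R)" using subgroup.subset[OF K] .
  have "word_eval (presented_group R) (\<lambda>g. word_class R [(g, True)]) w \<in> K" for w
  proof (induction w)
    case (Cons l w)
    then show ?case
      using gens subgroup.m_closed[OF K] subgroup.m_inv_closed[OF K] by (cases l) auto
  qed (simp add: subgroup.one_closed[OF K])
  then have "word_class R w \<in> K" for w by (metis word_class_eq_eval)
  then show "carrier (presented_group R) \<subseteq> K" by auto
qed


section \<open>The lower central series\<close>

lemma (in group) commutator_subgroup_normal:
  assumes H: "H \<lhd> G" and K: "K \<lhd> G"
  shows "commutator_subgroup G H K \<lhd> G"
  unfolding commutator_subgroup_def
proof (rule normal_generateI)
  have sub: "H \<subseteq> carrier G" "K \<subseteq> carrier G"
    using H K by (auto dest: normal_imp_subgroup subgroup.subset)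
  then show "{h \<otimes> k \<otimes> inv h \<otimes> inv k | h k. h \<in> H \<and> k \<in> K} \<subseteq> carrier G"
    by blast
  fix u g assume "u \<in> {h \<otimes> k \<otimes> inv h \<otimes> inv k | h k. h \<in> H \<and> k \<in> K}" and g: "g \<in> carrier G"
  then obtain h k where hk: "h \<in> H" "k \<in> K" and u: "u = h \<otimes> k \<otimes> inv h \<otimes> inv k" by blast
  have c: "h \<in> carrier G" "k \<in> carrier G" using hk sub by auto
  have "g \<otimes> u \<otimes> inv g = (g \<otimes> h \<otimes> inv g) \<otimes> (g \<otimes> k \<otimes> inv g) \<otimes>
      inv (g \<otimes> h \<otimes> inv g) \<otimes> inv (g \<otimes> k \<otimes> inv g)"
    using g c by (simp add: u inv_mult_group m_assoc inv_solve_left' flip: m_assoc)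
                 (simp add: m_assoc inv_solve_left)
  moreover have "g \<otimes> h \<otimes> inv g \<in> H" "g \<otimes> k \<otimes> inv g \<in> K"
    using H K hk g by (auto simp: normal_inv_iff)
  ultimately show "g \<otimes> u \<otimes> inv g \<in> {h \<otimes> k \<otimes> inv h \<otimes> inv k | h k. h \<in> H \<and> k \<in> K}"
    by blast
qed

lemma (in group) carrier_normal: "carrier G \<lhd> G"
  by (auto simp: normal_inv_iff subgroup_self)

lemma (in group) lower_central_normal: "lower_central G k \<lhd> G"
  by (induction k rule: induct_nat_012) (auto simp: carrier_normal commutator_subgroup_normal)

text \<open>
  Forming images commutes with forming commutator subgroups.  This gives both halves of the
  functoriality of the lower central series: a homomorphism maps each term into the corresponding one,
  and onto it when it is surjective.
\<close>

lemma (in group_hom) commutator_subgroup_image: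
  assumes "A \<subseteq> carrier G" "B \<subseteq> carrier G"
  shows "h ` commutator_subgroup G A B = commutator_subgroup H (h ` A) (h ` B)"
proof -
  let ?C = "{a \<otimes> b \<otimes> inv a \<otimes> inv b | a b. a \<in> A \<and> b \<in> B}"
  have im: "h (a \<otimes> b \<otimes> inv a \<otimes> inv b) = h a \<otimes>\<^bsub>H\<^esub> h b \<otimes>\<^bsub>H\<^esub> inv\<^bsub>H\<^esub> h a \<otimes>\<^bsub>H\<^esub> inv\<^bsub>H\<^esub> h b"
    if "a \<in> A" "b \<in> B" for a b
    using that assms by (simp add: subset_iff)
  have "h ` ?C = {a \<otimes>\<^bsub>H\<^esub> b \<otimes>\<^bsub>H\<^esub> inv\<^bsub>H\<^esub> a \<otimes>\<^bsub>H\<^esub> inv\<^bsub>H\<^esub> b | a b. a \<in> h ` A \<and> b \<in> h ` B}"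
  proof (intro equalityI subsetI)
    fix z assume "z \<in> h ` ?C"
    then show "z \<in> {a \<otimes>\<^bsub>H\<^esub> b \<otimes>\<^bsub>H\<^esub> inv\<^bsub>H\<^esub> a \<otimes>\<^bsub>H\<^esub> inv\<^bsub>H\<^esub> b | a b. a \<in> h ` A \<and> b \<in> h ` B}"
      using im by blast
  next
    fix z assume "z \<in> {a \<otimes>\<^bsub>H\<^esub> b \<otimes>\<^bsub>H\<^esub> inv\<^bsub>H\<^esub> a \<otimes>\<^bsub>H\<^esub> inv\<^bsub>H\<^esub> b | a b. a \<in> h ` A \<and> b \<in> h ` B}"
    then obtain a b where "a \<in> A" "b \<in> B" "z = h (a \<otimes> b \<otimes> inv a \<otimes> inv b)"
      using im by auto
    then show "z \<in> h ` ?C" by blast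
  qed
  moreover have "?C \<subseteq> carrier G" using assms by (auto simp: subset_iff)
  ultimately show ?thesis
    unfolding commutator_subgroup_def using generate_img[of ?C] by metis
qed

lemma lower_central_step:
  assumes "k \<ge> 1"
  shows "lower_central G (k + 1) = commutator_subgroup G (lower_central G k) (carrier G)"
  using assms by (cases k) auto

lemma (in group) lower_central_subset: "lower_central G k \<subseteq> carrier G"
  using normal_imp_subgroup[OF lower_central_normal] by (rule subgroup.subset)

lemma (in group) commutator_subgroup_mono:
  assumes "A \<subseteq> A'" "B \<subseteq> B'"
  shows "commutator_subgroup G A B \<subseteq> commutator_subgroup G A' B'"
  unfolding commutator_subgroup_def by (rule mono_generate) (use assms in blast)

lemma (in group_hom) lower_central_image_subset:
  "h ` lower_central G k \<subseteq> lower_central H k"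
proof (induction k rule: induct_nat_012)
  case (ge2 k)
  have "h ` lower_central G (Suc (Suc k)) =
      commutator_subgroup H (h ` lower_central G (Suc k)) (h ` carrier G)"
    by (simp add: commutator_subgroup_image G.lower_central_subset)
  also have "\<dots> \<subseteq> commutator_subgroup H (lower_central H (Suc k)) (carrier H)"
    using ge2(2) by (rule H.commutator_subgroup_mono) auto
  finally show ?case by simp
qed auto

lemma (in group_hom) lower_central_image_surj:
  assumes "h ` carrier G = carrier H"
  shows "h ` lower_central G k = lower_central H k"
proof (induction k rule: induct_nat_012)
  case (ge2 k)
  then show ?case
    by (simp add: commutator_subgroup_image G.lower_central_subset assms)
qed (simp_all add: assms)

text \<open>
  The quotient by \<open>\<gamma>\<^sub>k\<close> is nilpotent of class less than \<open>k\<close>; this is what lets a nilpotent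
  quotient itself serve as the target of its universal property.
\<close>

lemma (in group) lower_central_quotient:
  "lower_central (G Mod lower_central G k) k = {\<one>\<^bsub>G Mod lower_central G k\<^esub>}"
proof -
  let ?N = "lower_central G k"
  interpret N: normal ?N G by (rule lower_central_normal)
  interpret pr: group_hom G "G Mod ?N" "\<lambda>g. ?N #> g"
    by (intro group_hom.intro group_hom_axioms.intro N.factorgroup_is_group N.r_coset_hom_Mod is_group)
  have "?N #> g = ?N" if "g \<in> ?N" for g
    using coset_join2[of g ?N] that N.subgroup_axioms N.subset by auto
  moreover have "lower_central (G Mod ?N) k = (\<lambda>g. ?N #> g) ` ?N"
    by (rule pr.lower_central_image_surj[symmetric]) (simp add: carrier_FactGroup)
  ultimately show ?thesis by (auto simp: image_constant[OF N.one_closed])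
qed


section \<open>Integer powers modulo an integer\<close>

lemma mod_powi_cong_neg:
  "e \<le> 0 \<Longrightarrow> [ mod_powi k b e = modular_inverse k b ^ nat (- e)] (mod k)"
  by (auto simp: mod_powi_def cong_def)

lemma mod_powi_1: "[ mod_powi k b 1 = b] (mod k)"
  by (auto simp: mod_powi_def cong_def)

lemma mod_powi_0: "[ mod_powi k b 0 = 1] (mod k)"
  by (auto simp: mod_powi_def cong_def)

text \<open>
  Signs are distinguished here and not in the exponent law, which
  follows by induction in both directions, cancelling the unit \<open>b\<close> in the downward step.
\<close>

lemma mod_powi_succ:
  assumes "coprime b k"
  shows "[ mod_powi k b (e + 1) = b * mod_powi k b e] (mod k)"
proof (cases "e \<ge> 0")
  case True
  then show ?thesis
    by (simp add: mod_powi_def cong_def nat_add_distrib mod_mult_right_eq)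
next
  case False
  let ?b = "modular_inverse k b"
  have "nat (- e) = Suc (nat (- (e + 1)))" using False by simp
  then have "[b * mod_powi k b e = (b * ?b) * ?b ^ nat (- (e + 1))] (mod k)"
    using mod_powi_cong_neg[of e k b, THEN cong_scalar_left, of b] False by (simp add: mult.assoc)
  also have "[(b * ?b) * ?b ^ nat (- (e + 1)) = 1 * ?b ^ nat (- (e + 1))] (mod k)"
    by (intro cong_scalar_right cong_modular_inverse1 assms)
  also have "[1 * ?b ^ nat (- (e + 1)) = mod_powi k b (e + 1)] (mod k)"
    using mod_powi_cong_neg[of "e + 1" k b] False by (simp add: cong_sym)
  finally show ?thesis by (rule cong_sym)
qed

lemma mod_powi_add:
  assumes "coprime b k"
  shows "[ mod_powi k b (e + f) = mod_powi k b e * mod_powi k b f] (mod k)"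
proof (induction f rule: int_induct[where k = 0])
  case base
  show ?case using mod_powi_0[of k b, THEN cong_scalar_left, of "mod_powi k b e"] by (simp add: cong_sym)
next
  case (step1 f)
  have "[ mod_powi k b (e + (f + 1)) = b * mod_powi k b (e + f)] (mod k)"
    using mod_powi_succ[OF assms, of "e + f"] by (simp add: add.assoc)
  also have "[b * mod_powi k b (e + f) = b * (mod_powi k b e * mod_powi k b f)] (mod k)"
    using step1 by (intro cong_scalar_left)
  also have "b * (mod_powi k b e * mod_powi k b f) = mod_powi k b e * (b * mod_powi k b f)"
    by (simp add: ac_simps)
  also have "[\<dots> = mod_powi k b e * mod_powi k b (f + 1)] (mod k)"
    by (intro cong_scalar_left cong_sym[OF mod_powi_succ[OF assms]])
  finally show ?case .
next
  case (step2 f)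
  have "[b * mod_powi k b (e + (f - 1)) = mod_powi k b (e + f)] (mod k)"
    using mod_powi_succ[OF assms, of "e + (f - 1)"] by (simp add: cong_sym add.assoc)
  also have "[ mod_powi k b (e + f) = mod_powi k b e * mod_powi k b f] (mod k)"
    by (rule step2)
  also have "[ mod_powi k b e * mod_powi k b f = mod_powi k b e * (b * mod_powi k b (f - 1))] (mod k)"
    using mod_powi_succ[OF assms, of "f - 1"] by (intro cong_scalar_left) simp
  also have "mod_powi k b e * (b * mod_powi k b (f - 1)) = b * (mod_powi k b e * mod_powi k b (f - 1))"
    by (simp add: ac_simps)
  finally show ?case using assms by (simp add: cong_mult_lcancel)
qed


section \<open>Commuting generators\<close>

lemma (in group) centralizer_subgroup:
  assumes "h \<in> carrier G"
  shows "subgroup {g \<in> carrier G. g \<otimes> h = h \<otimes> g} G"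
proof (rule subgroupI)
  fix g assume "g \<in> {g \<in> carrier G. g \<otimes> h = h \<otimes> g}"
  then have g: "g \<in> carrier G" "g \<otimes> h = h \<otimes> g" by auto
  then have "h = inv g \<otimes> (h \<otimes> g)" by (metis assms inv_solve_left m_closed)
  then have "h \<otimes> inv g = inv g \<otimes> h" using g assms
    by (metis inv_closed inv_solve_right m_assoc m_closed)
  then show "inv g \<in> {g \<in> carrier G. g \<otimes> h = h \<otimes> g}" using g by simp
next
  fix g g' assume "g \<in> {g \<in> carrier G. g \<otimes> h = h \<otimes> g}" "g' \<in> {g \<in> carrier G. g \<otimes> h = h \<otimes> g}"
  then show "g \<otimes> g' \<in> {g \<in> carrier G. g \<otimes> h = h \<otimes> g}"
    using assms by simp (metis m_assoc)
qed (use assms in auto)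

text \<open>
  The double centralizer argument: the span of \<open>S\<close> lies in the centralizer of each element of \<open>S\<close>,
  so \<open>S\<close> lies in the centralizer of each element of its span, and then so does the span.
\<close>

lemma (in group) generate_commute:
  assumes S: "S \<subseteq> carrier G" and comm: "\<And>g h. g \<in> S \<Longrightarrow> h \<in> S \<Longrightarrow> g \<otimes> h = h \<otimes> g"
    and "g \<in> generate G S" "h \<in> generate G S"
  shows "g \<otimes> h = h \<otimes> g"
proof -
  have centralizes: "generate G S \<subseteq> {g \<in> carrier G. g \<otimes> h = h \<otimes> g}"
    if "h \<in> carrier G" "\<And>g. g \<in> S \<Longrightarrow> g \<otimes> h = h \<otimes> g" for h
    using S that by (intro generate_subgroup_incl centralizer_subgroup) auto
  have h: "h \<in> carrier G" using generate_in_carrier[OF S] assms by blast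
  have "g' \<otimes> h = h \<otimes> g'" if "g' \<in> S" for g'
  proof -
    have "g' \<in> carrier G" using S that by auto
    from centralizes[OF this] comm[OF _ that] assms(4) show ?thesis by auto
  qed
  with centralizes[OF h] assms(3) show ?thesis by auto
qed


section \<open>Finite cyclic groups extended by free abelian groups\<close>

text \<open>
  Up to isomorphism such a group is the semidirect product of \<open>\<int>/N\<close> and \<open>\<int>\<^sup>r\<close> in which \<open>s\<^sub>i\<close> acts as
  multiplication by \<open>q\<^sub>i\<close>, and \<open>\<sigma>\<^sub>j(g)\<close> is the exponent of \<open>s\<^sub>j\<close> in \<open>g\<close>.  The assumptions are
  the facts that a presentation yields directly; in particular endomorphisms come from the universal
  property, so no normal form for the elements has to be set up.
\<close>

locale cyclic_by_free_abelian = group G for G (structure) +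
  fixes x :: 'a and s :: "'r::finite \<Rightarrow> 'a" and q :: "'r \<Rightarrow> int" and N :: int
    and \<sigma> :: "'r \<Rightarrow> 'a \<Rightarrow> int"
  assumes x_closed [simp]: "x \<in> carrier G"
    and s_closed [simp]: "s i \<in> carrier G"
    and generated: "generate G (insert x (range s)) = carrier G"
    and s_commute: "s i \<otimes> s j = s j \<otimes> s i"
    and s_conj: "s i \<otimes> x \<otimes> inv s i = x [^] q i"
    and x_pow_eq_one: "x [^] (k::int) = \<one> \<longleftrightarrow> N dvd k"
    and N_pos: "N > 0"
    and coprime_q: "coprime (q i) N"
    and \<sigma>_mult: "g \<in> carrier G \<Longrightarrow> h \<in> carrier G \<Longrightarrow> \<sigma> j (g \<otimes> h) = \<sigma> j g + \<sigma> j h"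
    and \<sigma>_x: "\<sigma> j x = 0"
    and \<sigma>_s: "\<sigma> j (s i) = (if i = j then 1 else 0)"
    and endomorphism: "\<lbrakk>range s' \<subseteq> carrier G; \<And>i j. s' i \<otimes> s' j = s' j \<otimes> s' i;
      \<And>i. s' i \<otimes> x \<otimes> inv s' i = x [^] q i\<rbrakk> \<Longrightarrow> \<exists>\<phi>\<in>hom G G. \<phi> x = x \<and> (\<forall>i. \<phi> (s i) = s' i)"
begin

lemma generator_induct:
  assumes "subgroup K G" "x \<in> K" "\<And>i. s i \<in> K" "g \<in> carrier G"
  shows "g \<in> K"
  using generate_subgroup_incl[of "insert x (range s)" K] assms generated by auto

lemma \<sigma>_hom: "\<sigma> j \<in> hom G integer_group"
  by (rule homI) (auto simp: integer_group_def \<sigma>_mult)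

lemma \<sigma>_group_hom: "group_hom G integer_group (\<sigma> j)"
  by (intro group_hom.intro group_hom_axioms.intro \<sigma>_hom is_group group_integer_group)

lemma \<sigma>_one [simp]: "\<sigma> j \<one> = 0"
  using \<sigma>_mult[of \<one> \<one> j] by simp

lemma \<sigma>_inv: "g \<in> carrier G \<Longrightarrow> \<sigma> j (inv g) = - \<sigma> j g"
  using \<sigma>_mult[of g "inv g" j] by simp

lemma \<sigma>_pow: "g \<in> carrier G \<Longrightarrow> \<sigma> j (g [^] (k::int)) = k * \<sigma> j g"
  using group_hom.hom_int_pow[OF \<sigma>_group_hom[of j], of g k] by simp

lemma x_pow_eq_iff: "x [^] (k::int) = x [^] (l::int) \<longleftrightarrow> [k = l] (mod N)"
proof -
  have "x [^] k = x [^] l \<longleftrightarrow> x [^] (k - l) = \<one>"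
    by (simp add: int_pow_diff) (metis inv_equality inv_inv int_pow_closed x_closed r_inv inv_closed)
  then show ?thesis by (simp add: x_pow_eq_one cong_iff_dvd_diff)
qed

text \<open>
  The character of \<open>\<int>\<^sup>r\<close> with values in the units modulo \<open>N\<close> that sends the \<open>i\<close>-th unit vector to
  \<open>q\<^sub>i\<close>; being an integer representative, it is multiplicative only up to congruence.
\<close>

definition chi :: "('r \<Rightarrow> int) \<Rightarrow> int" where
  "chi b = (\<Prod>j\<in>UNIV. mod_powi N (q j) (b j))"

lemma chi_0: "[chi (\<lambda>_. 0) = 1] (mod N)"
proof -
  have "[chi (\<lambda>_. 0) = (\<Prod>j\<in>(UNIV::'r set). 1)] (mod N)"
    unfolding chi_def by (intro cong_prod mod_powi_0)
  then show ?thesis by simp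
qed

lemma chi_add: "[chi (\<lambda>j. b j + d j) = chi b * chi d] (mod N)"
  unfolding chi_def by (subst prod.distrib[symmetric]) (intro cong_prod mod_powi_add coprime_q)

lemma chi_unit: "[chi (\<lambda>j. if i = j then 1 else 0) = q i] (mod N)"
proof -
  have "[chi (\<lambda>j. if i = j then 1 else 0) = (\<Prod>j\<in>UNIV. if i = j then q j else 1)] (mod N)"
    unfolding chi_def by (intro cong_prod) (auto simp: mod_powi_0 mod_powi_1)
  then show ?thesis by simp
qed

lemma conj_pow:
  assumes "g \<in> carrier G" "h \<in> carrier G"
  shows "g \<otimes> h [^] (k::int) \<otimes> inv g = (g \<otimes> h \<otimes> inv g) [^] k"
proof -
  have "(\<lambda>h. g \<otimes> h \<otimes> inv g) \<in> hom G G"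
    using assms(1) by (intro homI) (auto simp: m_assoc inv_solve_left)
  from hom_int_pow[OF this assms(2) is_group is_group] show ?thesis .
qed

text \<open>
  The elements with this property form a subgroup because \<open>chi\<close> is multiplicative, and the generators
  belong to it: \<open>x\<close> has zero exponents, and \<open>s\<^sub>i\<close> acts on \<open>x\<close> by the power \<open>q\<^sub>i\<close>.
\<close>

lemma conj_x:
  assumes "g \<in> carrier G"
  shows "g \<otimes> x \<otimes> inv g = x [^] chi (\<lambda>j. \<sigma> j g)"
proof -
  let ?K = "{g \<in> carrier G. g \<otimes> x \<otimes> inv g = x [^] chi (\<lambda>j. \<sigma> j g)}"
  have "subgroup ?K G"
  proof (rule subgroupI)
    have "x = x [^] chi (\<lambda>_. 0)"
      using chi_0 x_pow_eq_iff[of 1 "chi (\<lambda>_. 0)"] by (simp add: cong_sym_eq)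
    then have "\<one> \<in> ?K" by simp
    then show "?K \<noteq> {}" by blast
  next
    fix g assume "g \<in> ?K"
    then have g: "g \<in> carrier G" "g \<otimes> x \<otimes> inv g = x [^] chi (\<lambda>j. \<sigma> j g)" by auto
    let ?k = "chi (\<lambda>j. - \<sigma> j g)"
    have "g \<otimes> x [^] ?k \<otimes> inv g = x [^] (chi (\<lambda>j. \<sigma> j g) * ?k)"
      using g by (simp add: conj_pow int_pow_pow)
    also have "\<dots> = x [^] (1::int)"
      unfolding x_pow_eq_iff using chi_add[of "\<lambda>j. \<sigma> j g" "\<lambda>j. - \<sigma> j g"] chi_0
      by (simp add: cong_def)
    finally have "g \<otimes> x [^] ?k \<otimes> inv g = x" by simp
    then have "g \<otimes> x [^] ?k = x \<otimes> g" using g by (metis inv_solve_right' int_pow_closed m_closed x_closed)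
    then have "x [^] ?k = inv g \<otimes> x \<otimes> g"
      using g by (metis inv_closed inv_solve_left int_pow_closed m_assoc m_closed x_closed)
    then show "inv g \<in> ?K" using g by (simp add: \<sigma>_inv)
  next
    fix g h assume "g \<in> ?K" "h \<in> ?K"
    then have g: "g \<in> carrier G" "g \<otimes> x \<otimes> inv g = x [^] chi (\<lambda>j. \<sigma> j g)"
      and h: "h \<in> carrier G" "h \<otimes> x \<otimes> inv h = x [^] chi (\<lambda>j. \<sigma> j h)" by auto
    have "g \<otimes> h \<otimes> x \<otimes> inv (g \<otimes> h) = g \<otimes> (h \<otimes> x \<otimes> inv h) \<otimes> inv g"
      using g(1) h(1) by (simp add: inv_mult_group m_assoc)
    also have "\<dots> = x [^] (chi (\<lambda>j. \<sigma> j g) * chi (\<lambda>j. \<sigma> j h))"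
      using g h by (simp add: conj_pow int_pow_pow)
    also have "\<dots> = x [^] chi (\<lambda>j. \<sigma> j (g \<otimes> h))"
      unfolding x_pow_eq_iff using g h by (simp add: \<sigma>_mult cong_sym[OF chi_add])
    finally show "g \<otimes> h \<in> ?K" using g h by simp
  qed auto
  moreover have "x = x [^] chi (\<lambda>_. 0)"
    using chi_0 x_pow_eq_iff[of 1 "chi (\<lambda>_. 0)"] by (simp add: cong_sym_eq)
  then have "x \<in> ?K" by (simp add: \<sigma>_x m_assoc)
  moreover have "s i \<in> ?K" for i
    using chi_unit[of i] x_pow_eq_iff by (simp add: \<sigma>_s s_conj cong_sym_eq)
  ultimately show ?thesis using generator_induct[of ?K g] assms by blast
qed

text \<open>
  This is the torsion subgroup, as lemma \<open>torsion_eq_T\<close> shows; as a cyclic group it is easier to divide out.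
\<close>

definition T :: "'a set" where "T = generate G {x}"

lemma T_iff: "g \<in> T \<longleftrightarrow> (\<exists>k::int. g = x [^] k)"
  by (auto simp: T_def generate_pow)

lemma T_normal: "T \<lhd> G"
proof (rule normal_invI)
  show "subgroup T G" unfolding T_def by (rule generate_is_subgroup) simp
  fix g h assume "g \<in> carrier G" "h \<in> T"
  then show "g \<otimes> h \<otimes> inv g \<in> T" by (auto simp: T_iff conj_pow conj_x int_pow_pow)
qed

sublocale T: normal T G by (rule T_normal)

sublocale quot: group_hom G "G Mod T" "\<lambda>g. T #> g"
  by (intro group_hom.intro group_hom_axioms.intro T.factorgroup_is_group T.r_coset_hom_Mod is_group)

lemma coset_T_x: "T #> x = T"
  using coset_join2[OF x_closed T.subgroup_axioms] T_iff[of x] int_pow_1[OF x_closed] by metis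

text \<open>
  The quotient by \<open>\<langle>x\<rangle>\<close> is generated by the images of the commuting elements \<open>s\<^sub>i\<close>.
\<close>

lemma quot_comm: "comm_group (G Mod T)"
proof (rule quot.H.group_comm_groupI)
  fix C D assume CD: "C \<in> carrier (G Mod T)" "D \<in> carrier (G Mod T)"
  let ?S = "(\<lambda>g. T #> g) ` insert x (range s)"
  have "generate (G Mod T) ?S = carrier (G Mod T)"
    by (subst quot.generate_img) (auto simp: generated carrier_FactGroup)
  moreover have "g \<otimes>\<^bsub>G Mod T\<^esub> h = h \<otimes>\<^bsub>G Mod T\<^esub> g" if gh: "g \<in> ?S" "h \<in> ?S" for g h
  proof -
    have 1: "c = \<one>\<^bsub>G Mod T\<^esub> \<or> (\<exists>i. c = T #> s i)" if "c \<in> ?S" for c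
      using that by (auto simp: coset_T_x)
    have 2: "(T #> s i) \<otimes>\<^bsub>G Mod T\<^esub> (T #> s j) = (T #> s j) \<otimes>\<^bsub>G Mod T\<^esub> (T #> s i)" for i j
      using s_commute[of i j] by (metis quot.hom_mult s_closed)
    have "T #> s i \<in> carrier (G Mod T)" for i by simp
    then show ?thesis using 1[OF gh(1)] 1[OF gh(2)] 2
      by (metis quot.H.l_one quot.H.r_one)
  qed
  moreover have "?S \<subseteq> carrier (G Mod T)" by (auto simp: carrier_FactGroup)
  ultimately show "C \<otimes>\<^bsub>G Mod T\<^esub> D = D \<otimes>\<^bsub>G Mod T\<^esub> C"
    using quot.H.generate_commute[of ?S C D] CD by metis
qed

sublocale quot_comm: comm_group "G Mod T" by (rule quot_comm)

text \<open>
  Both sides are homomorphisms to the abelian quotient, so they need to be compared only on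
  generators.  It follows that \<open>\<langle>x\<rangle>\<close> is the whole common kernel of the \<open>\<sigma>\<^sub>j\<close>.
\<close>

lemma coset_T_eq_finprod:
  assumes "g \<in> carrier G"
  shows "T #> g = finprod (G Mod T) (\<lambda>j. (T #> s j) [^]\<^bsub>G Mod T\<^esub> \<sigma> j g) UNIV"
proof -
  let ?f = "\<lambda>g. finprod (G Mod T) (\<lambda>j. (T #> s j) [^]\<^bsub>G Mod T\<^esub> \<sigma> j g) UNIV"
  let ?K = "{g \<in> carrier G. T #> g = ?f g}"
  have f_mult: "?f (g \<otimes> h) = ?f g \<otimes>\<^bsub>G Mod T\<^esub> ?f h" if "g \<in> carrier G" "h \<in> carrier G" for g h
    using that by (simp add: \<sigma>_mult quot.H.int_pow_mult quot_comm.finprod_multf Pi_def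
        del: mult_FactGroup one_FactGroup)
  have f_one: "?f \<one> = \<one>\<^bsub>G Mod T\<^esub>" by (simp del: one_FactGroup)
  have f_closed: "?f g \<in> carrier (G Mod T)" for g by simp
  have "subgroup ?K G"
  proof (rule subgroupI)
    show "?K \<noteq> {}" using f_one quot.hom_one by blast
  next
    fix g assume "g \<in> ?K"
    then have g: "g \<in> carrier G" "T #> g = ?f g" by auto
    have "?f (inv g) \<otimes>\<^bsub>G Mod T\<^esub> ?f g = \<one>\<^bsub>G Mod T\<^esub>"
      using f_mult[of "inv g" g] g f_one by simp
    then have "inv\<^bsub>G Mod T\<^esub> ?f g = ?f (inv g)" by (rule quot.H.inv_equality) (rule f_closed)+
    then show "inv g \<in> ?K" using g by simp
  next
    fix g h assume "g \<in> ?K" "h \<in> ?K"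
    then show "g \<otimes> h \<in> ?K" using f_mult[of g h] by simp
  qed auto
  moreover have "T #> x = \<one>\<^bsub>G Mod T\<^esub>" by (simp add: coset_T_x)
  then have "x \<in> ?K" by (simp add: \<sigma>_x del: one_FactGroup)
  moreover have "s i \<in> ?K" for i
  proof -
    have "?f (s i) = finprod (G Mod T) (\<lambda>j. if i = j then T #> s j else \<one>\<^bsub>G Mod T\<^esub>) UNIV"
      by (intro quot_comm.finprod_cong) (auto simp: \<sigma>_s simp_implies_def simp del: one_FactGroup)
    also have "\<dots> = T #> s i"
      by (rule quot_comm.finprod_singleton) auto
    finally show ?thesis by simp
  qed
  ultimately show ?thesis using generator_induct[of ?K g] assms by blast
qed

lemma \<sigma>_T: "g \<in> T \<Longrightarrow> \<sigma> j g = 0"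
  by (auto simp: T_iff \<sigma>_pow \<sigma>_x)

lemma \<sigma>_kernel:
  assumes "g \<in> carrier G" "\<And>j. \<sigma> j g = 0"
  shows "g \<in> T"
proof -
  have "T #> g = T #> \<one>"
    using coset_T_eq_finprod[OF assms(1)] coset_T_eq_finprod[OF one_closed] assms(2) by simp
  then have "T #> g = T" by (simp add: T.subset)
  then show ?thesis using coset_join1 assms(1) T.subgroup_axioms by blast
qed

text \<open>
  An element of finite order has exponents zero since \<open>\<int>\<close> is torsion-free.
\<close>

lemma torsion_eq_T: "torsion G = T"
proof (intro equalityI subsetI)
  fix g assume "g \<in> torsion G"
  then obtain k :: nat where g: "g \<in> carrier G" and k: "k > 0" "g [^] int k = \<one>"
    by (auto simp: torsion_def int_pow_int)
  have "\<sigma> j g = 0" for j using \<sigma>_pow[OF g, of j "int k"] k by simp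
  with g show "g \<in> T" by (rule \<sigma>_kernel)
next
  fix g assume "g \<in> T"
  then obtain k :: int where g: "g = x [^] k" by (auto simp: T_iff)
  have "g [^] nat N = g [^] N" using N_pos by (simp add: pow_nat)
  also have "\<dots> = \<one>" by (simp add: g int_pow_pow x_pow_eq_one)
  finally show "g \<in> torsion G" using N_pos g by (auto simp: torsion_def intro!: exI[of _ "nat N"])
qed

lemma coset_T_eq_iff:
  assumes "g \<in> carrier G" "h \<in> carrier G"
  shows "T #> g = T #> h \<longleftrightarrow> (\<forall>j. \<sigma> j g = \<sigma> j h)"
proof
  assume "T #> g = T #> h"
  then have "g \<in> T #> h" using rcos_self[OF assms(1) T.subgroup_axioms] by simp
  then obtain z where "z \<in> T" "g = z \<otimes> h" by (auto simp: r_coset_def)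
  then show "\<forall>j. \<sigma> j g = \<sigma> j h" using assms T.subset by (auto simp: \<sigma>_mult \<sigma>_T)
next
  assume "\<forall>j. \<sigma> j g = \<sigma> j h"
  then show "T #> g = T #> h" using coset_T_eq_finprod[OF assms(1)] coset_T_eq_finprod[OF assms(2)] by simp
qed

lemma s_span_closed: "g \<in> generate G (range s) \<Longrightarrow> g \<in> carrier G"
  by (rule generate_in_carrier[of "range s"]) auto

lemma s_span_commute:
  assumes "g \<in> generate G (range s)" "h \<in> generate G (range s)"
  shows "g \<otimes> h = h \<otimes> g"
  using assms by (rule generate_commute[rotated 2]) (auto simp: s_commute)

text \<open>
  The preimages are taken in the span of the \<open>s\<^sub>i\<close>, where elements commute, so that they can serve as
  images of the \<open>s\<^sub>i\<close> under an endomorphism.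
\<close>

lemma \<sigma>_surj: "\<exists>g\<in>generate G (range s). \<forall>j. \<sigma> j g = b j"
proof -
  have sub: "subgroup (generate G (range s)) G" by (rule generate_is_subgroup) auto
  have "\<exists>g\<in>generate G (range s). \<forall>j. \<sigma> j g = (if j \<in> F then b j else 0)" if "finite F" for F
    using that
  proof (induction F rule: finite_induct)
    case empty
    show ?case by (rule bexI[of _ \<one>]) (auto intro: generate.one)
  next
    case (insert i F)
    then obtain g where g: "g \<in> generate G (range s)" "\<forall>j. \<sigma> j g = (if j \<in> F then b j else 0)"
      by blast
    then have c: "g \<in> carrier G" by (simp add: s_span_closed)
    have "s i [^] b i \<in> generate G (range s)"
      using subgroup_int_pow_closed[OF sub] generate.incl[of "s i" "range s"] by auto
    then have "g \<otimes> s i [^] b i \<in> generate G (range s)"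
      using g by (intro generate.eng)
    then show ?case
      by (rule bexI[rotated]) (use insert g c in \<open>auto simp: \<sigma>_mult \<sigma>_pow \<sigma>_s\<close>)
  qed
  from this[of UNIV] show ?thesis by simp
qed

lemma induced_coset:
  assumes \<phi>: "\<phi> \<in> hom G G" "\<phi> x \<in> T" and g: "g \<in> carrier G"
  shows "induced G T \<phi> (T #> g) = T #> \<phi> g"
proof -
  interpret \<phi>: group_hom G G \<phi>
    by (intro group_hom.intro group_hom_axioms.intro \<phi> is_group)
  have "T #> \<phi> h = T #> \<phi> g" if h: "h \<in> T #> g" for h
  proof -
    obtain k :: int where "h = x [^] k \<otimes> g" using h by (auto simp: r_coset_def T_iff)
    then have "\<phi> h = \<phi> x [^] k \<otimes> \<phi> g" using g by (simp add: \<phi>.hom_int_pow)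
    then show ?thesis using g \<phi>(2) by (subst coset_T_eq_iff) (auto simp: \<sigma>_mult \<sigma>_pow \<sigma>_T)
  qed
  then have "(\<lambda>h. T #> \<phi> h) ` (T #> g) = {T #> \<phi> g}"
    using rcos_self[OF g T.subgroup_axioms] by blast
  then show ?thesis by (simp add: induced_def)
qed

text \<open>
  Both sides of each defining equation of \<open>has_matrix\<close> are cosets, and cosets are determined by
  exponents; hence the matrix of \<open>\<phi>\<close> can be read off from the \<open>\<sigma>\<^sub>j\<close> before passing to the quotient.
\<close>

lemma has_matrix_iff:
  assumes \<phi>: "\<phi> \<in> hom G G" "\<phi> x \<in> T"
  shows "has_matrix (G Mod T) (\<lambda>i. T #> s i) (induced G T \<phi>) M \<longleftrightarrow>
    (\<forall>i j. \<sigma> j (\<phi> (s i)) = M $ j $ i)"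
proof -
  have "induced G T \<phi> (T #> s i) = finprod (G Mod T) (\<lambda>j. (T #> s j) [^]\<^bsub>G Mod T\<^esub> M $ j $ i) UNIV
      \<longleftrightarrow> (\<forall>j. \<sigma> j (\<phi> (s i)) = M $ j $ i)" for i
  proof -
    obtain g where g: "g \<in> generate G (range s)" "\<forall>j. \<sigma> j g = M $ j $ i"
      using \<sigma>_surj[of "\<lambda>j. M $ j $ i"] by blast
    then have c: "g \<in> carrier G" by (simp add: s_span_closed)
    have "finprod (G Mod T) (\<lambda>j. (T #> s j) [^]\<^bsub>G Mod T\<^esub> M $ j $ i) UNIV = T #> g"
      using coset_T_eq_finprod[OF c] g by simp
    moreover have "\<phi> (s i) \<in> carrier G" using \<phi>(1) by (rule hom_in_carrier) simp
    ultimately show ?thesis using c g by (simp add: induced_coset[OF \<phi>] coset_T_eq_iff)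
  qed
  then show ?thesis by (simp add: has_matrix_def)
qed

text \<open>
  Conjugating \<open>\<phi>(x)\<close> by \<open>\<phi>(s\<^sub>i)\<close> raises it to the power \<open>q\<^sub>i\<close>, since \<open>\<phi>\<close> is a homomorphism, and to
  the power \<open>chi\<close> of the \<open>i\<close>-th column, since \<open>\<phi>(x)\<close> is a power of \<open>x\<close>.  Pulling the equality of
  these powers back along \<open>\<phi>\<close> turns it into one between powers of \<open>x\<close>, so it does not matter which
  generator of \<open>\<langle>x\<rangle>\<close> the element \<open>\<phi>(x)\<close> is.
\<close>

lemma chi_column_necessary:
  assumes \<phi>: "\<phi> \<in> iso G G" and M: "has_matrix (G Mod T) (\<lambda>i. T #> s i) (induced G T \<phi>) M"
  shows "[chi (\<lambda>j. M $ j $ i) = q i] (mod N)"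
proof -
  have hom: "\<phi> \<in> hom G G" and inj: "inj_on \<phi> (carrier G)"
    using \<phi> by (auto simp: iso_def bij_betw_def)
  interpret \<phi>: group_hom G G \<phi>
    by (intro group_hom.intro group_hom_axioms.intro hom is_group)
  have "x \<in> torsion G" using T_iff[of x] int_pow_1[OF x_closed] torsion_eq_T by metis
  then have "\<phi> x \<in> torsion G"
    by (auto simp: torsion_def simp flip: \<phi>.hom_nat_pow)
  then have \<phi>x: "\<phi> x \<in> T" by (simp add: torsion_eq_T)
  then obtain u :: int where u: "\<phi> x = x [^] u" by (auto simp: T_iff)
  have \<sigma>_eq: "\<sigma> j (\<phi> (s i)) = M $ j $ i" for j using has_matrix_iff[OF hom \<phi>x] M by blast
  have "\<phi> (x [^] q i) = \<phi> (s i \<otimes> x \<otimes> inv s i)" by (simp only: s_conj)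
  also have "\<dots> = \<phi> (s i) \<otimes> x [^] u \<otimes> inv \<phi> (s i)" by (simp add: u)
  also have "\<dots> = (x [^] chi (\<lambda>j. M $ j $ i)) [^] u" by (simp add: conj_pow conj_x \<sigma>_eq)
  also have "\<dots> = \<phi> x [^] chi (\<lambda>j. M $ j $ i)" by (simp add: u int_pow_pow mult.commute)
  also have "\<dots> = \<phi> (x [^] chi (\<lambda>j. M $ j $ i))" by (simp add: \<phi>.hom_int_pow)
  finally have "x [^] q i = x [^] chi (\<lambda>j. M $ j $ i)"
    using inj by (auto dest: inj_onD)
  then show ?thesis by (simp add: x_pow_eq_iff cong_sym_eq)
qed

lemma \<sigma>_endomorphism:
  assumes \<phi>: "\<phi> \<in> hom G G" "\<phi> x \<in> T" "\<And>i j. \<sigma> j (\<phi> (s i)) = M $ j $ i" and "g \<in> carrier G"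
  shows "\<sigma> j (\<phi> g) = (\<Sum>i\<in>UNIV. M $ j $ i * \<sigma> i g)"
proof -
  interpret \<phi>: group_hom G G \<phi>
    by (intro group_hom.intro group_hom_axioms.intro \<phi> is_group)
  let ?K = "{g \<in> carrier G. \<sigma> j (\<phi> g) = (\<Sum>i\<in>UNIV. M $ j $ i * \<sigma> i g)}"
  have "subgroup ?K G"
  proof (rule subgroupI)
    show "?K \<noteq> {}" using one_closed by (auto intro!: exI[of _ \<one>])
  qed (auto simp: \<sigma>_mult \<sigma>_inv distrib_left sum.distrib sum_negf)
  moreover have "x \<in> ?K" by (simp add: \<sigma>_x \<sigma>_T[OF \<phi>(2)])
  moreover have "s i \<in> ?K" for i
    by (simp add: \<sigma>_s \<phi>(3) if_distrib cong: if_cong)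
  ultimately show ?thesis using generator_induct[of ?K g] assms by blast
qed

text \<open>
  The endomorphism fixing \<open>x\<close> and sending \<open>s\<^sub>i\<close> to an element whose exponents are the \<open>i\<close>-th column is
  well defined by the congruence.  It restricts to the identity on \<open>\<langle>x\<rangle>\<close> and induces the bijection
  \<open>M\<close> on exponents, so it is bijective, as in the five lemma.
\<close>

lemma chi_column_sufficient:
  fixes M :: "int^'r^'r"
  assumes "invertible M" and chi: "\<And>i. [chi (\<lambda>j. M $ j $ i) = q i] (mod N)"
  shows "\<exists>\<phi>\<in>iso G G. has_matrix (G Mod T) (\<lambda>i. T #> s i) (induced G T \<phi>) M"
proof -
  obtain M' where M': "M ** M' = mat 1" "M' ** M = mat 1"
    using \<open>invertible M\<close> by (auto simp: invertible_def)
  obtain s' where s': "\<And>i. s' i \<in> generate G (range s)" "\<And>i j. \<sigma> j (s' i) = M $ j $ i"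
    using \<sigma>_surj[of "\<lambda>j. M $ j $ _"] by metis
  have s'_closed: "s' i \<in> carrier G" for i using s'(1) by (rule s_span_closed)
  have "s' i \<otimes> x \<otimes> inv s' i = x [^] q i" for i
    using chi[of i] by (simp add: conj_x[OF s'_closed] s'(2) x_pow_eq_iff)
  then obtain \<phi> where \<phi>: "\<phi> \<in> hom G G" "\<phi> x = x" "\<And>i. \<phi> (s i) = s' i"
    using endomorphism[of s'] s'_closed s_span_commute[OF s'(1) s'(1)] by blast
  interpret \<phi>: group_hom G G \<phi>
    by (intro group_hom.intro group_hom_axioms.intro \<phi> is_group)
  have \<phi>x: "\<phi> x \<in> T" using T_iff[of x] int_pow_1[OF x_closed] \<phi>(2) by metis
  have \<sigma>\<phi>: "\<sigma> j (\<phi> g) = (\<Sum>i\<in>UNIV. M $ j $ i * \<sigma> i g)" if "g \<in> carrier G" for j g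
    using \<sigma>_endomorphism[OF \<phi>(1) \<phi>x _ that] s'(2) \<phi>(3) by simp
  define v where "v g = (\<chi> j. \<sigma> j g)" for g
  have v\<phi>: "v (\<phi> g) = M *v v g" if "g \<in> carrier G" for g
    using \<sigma>\<phi>[OF that] by (simp add: v_def matrix_vector_mult_def vec_eq_iff)
  have fix_T: "\<phi> g = g" if "g \<in> T" for g
    using that by (auto simp: T_iff \<phi>.hom_int_pow \<phi>(2))
  have "g = \<one>" if g: "g \<in> carrier G" "\<phi> g = \<one>" for g
  proof -
    have "v g = M' *v (M *v v g)" by (simp add: matrix_vector_mul_assoc M')
    also have "M *v v g = v (\<phi> g)" by (rule v\<phi>[OF g(1), symmetric])
    also have "\<dots> = 0" by (simp add: g v_def vec_eq_iff)
    finally have "\<sigma> j g = 0" for j by (simp add: v_def vec_eq_iff)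
    then have "g \<in> T" using g \<sigma>_kernel by blast
    then show ?thesis using fix_T g by simp
  qed
  then have "inj_on \<phi> (carrier G)" by (simp add: \<phi>.inj_on_one_iff)
  moreover have "g \<in> \<phi> ` carrier G" if g: "g \<in> carrier G" for g
  proof -
    obtain h where h: "h \<in> generate G (range s)" "\<forall>j. \<sigma> j h = (M' *v v g) $ j"
      using \<sigma>_surj[of "\<lambda>j. (M' *v v g) $ j"] by blast
    then have c: "h \<in> carrier G" by (simp add: s_span_closed)
    have "v h = M' *v v g" using h by (simp add: v_def vec_eq_iff)
    then have "v (\<phi> h) = v g" using v\<phi>[OF c] by (simp add: matrix_vector_mul_assoc M')
    then have "\<sigma> j (\<phi> h) = \<sigma> j g" for j by (simp add: v_def vec_eq_iff)
    then have z: "g \<otimes> inv \<phi> h \<in> T"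
      using g c by (intro \<sigma>_kernel) (auto simp: \<sigma>_mult \<sigma>_inv)
    then have "\<phi> (g \<otimes> inv \<phi> h \<otimes> h) = g \<otimes> inv \<phi> h \<otimes> \<phi> h"
      using g c T.subset fix_T[OF z] by simp
    also have "\<dots> = g" using g c by (simp add: m_assoc)
    finally show ?thesis using g c by (intro image_eqI[of _ _ "g \<otimes> inv \<phi> h \<otimes> h"]) auto
  qed
  ultimately have "\<phi> \<in> iso G G"
    using \<phi>(1) by (auto simp: iso_def bij_betw_def)
  moreover have "has_matrix (G Mod T) (\<lambda>i. T #> s i) (induced G T \<phi>) M"
    using has_matrix_iff[OF \<phi>(1) \<phi>x] s'(2) \<phi>(3) by simp
  ultimately show ?thesis by blast
qed

theorem matrix_realizable_iff:
  fixes M :: "int^'r^'r"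
  assumes "invertible M"
  shows "(\<exists>\<phi>\<in>iso G G. has_matrix (G Mod torsion G) (\<lambda>i. torsion G #> s i)
      (induced G (torsion G) \<phi>) M) \<longleftrightarrow>
    (\<forall>i. [(\<Prod>j\<in>UNIV. mod_powi N (q j) (M $ j $ i)) = q i] (mod N))"
  using chi_column_necessary chi_column_sufficient[OF assms]
  unfolding torsion_eq_T chi_def by blast

end


section \<open>A nilpotent group of affine maps\<close>

text \<open>
  The pair \<open>(u, v)\<close> stands for the map \<open>z \<mapsto> u z + v\<close> on \<open>\<int>/m\<^sup>c\<close>.  The condition \<open>u \<equiv> 1\<close> modulo \<open>m\<close>
  makes the group nilpotent of class at most \<open>c\<close>, and the translation by \<open>1\<close> has order exactly \<open>m\<^sup>c\<close>.
\<close>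

definition affine_group :: "int \<Rightarrow> nat \<Rightarrow> (int \<times> int) monoid" where
  "affine_group m c =
    \<lparr>carrier = {(u, v). 0 \<le> u \<and> u < m ^ c \<and> 0 \<le> v \<and> v < m ^ c \<and> [u = 1] (mod m)},
     mult = (\<lambda>(u, v) (u', v'). (u * u' mod m ^ c, (v + u * v') mod m ^ c)),
     one = (1 mod m ^ c, 0)\<rparr>"

lemma cong_mod_power:
  fixes a b m :: int
  assumes "d dvd m"
  shows "[a mod m = b] (mod d) \<longleftrightarrow> [a = b] (mod d)"
  using assms by (simp add: cong_def mod_mod_cancel)

lemma coprime_power_of_cong_1:
  fixes u m :: int
  assumes "[u = 1] (mod m)"
  shows "coprime u (m ^ c)"
  using cong_imp_coprime[OF cong_sym[OF assms]] by simp

context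
  fixes m :: int and c :: nat
  assumes m_pos: "m > 0" and c_pos: "c \<ge> 1"
begin

lemma m_dvd_power: "m dvd m ^ c"
  using c_pos by simp

lemma affine_group_closed_mod:
  "(u mod m ^ c, v mod m ^ c) \<in> carrier (affine_group m c) \<longleftrightarrow> [u = 1] (mod m)"
  using m_pos by (simp add: affine_group_def cong_mod_power[OF m_dvd_power])

lemma mult_affine_group:
  "(u, v) \<otimes>\<^bsub>affine_group m c\<^esub> (u', v') = (u * u' mod m ^ c, (v + u * v') mod m ^ c)"
  by (simp add: affine_group_def)

lemma one_affine_group: "\<one>\<^bsub>affine_group m c\<^esub> = (1 mod m ^ c, 0)"
  by (simp add: affine_group_def)

lemma group_affine_group: "group (affine_group m c)"
proof (rule groupI)
  show "\<one>\<^bsub>affine_group m c\<^esub> \<in> carrier (affine_group m c)"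
    using affine_group_closed_mod[of 1 0] by (simp add: one_affine_group)
next
  fix g h assume g: "g \<in> carrier (affine_group m c)" and h: "h \<in> carrier (affine_group m c)"
  obtain u v u' v' where [simp]: "g = (u, v)" "h = (u', v')" by (cases g, cases h)
  have "[u = 1] (mod m)" "[u' = 1] (mod m)" using g h by (auto simp: affine_group_def)
  then have "[u * u' = 1] (mod m)" using cong_mult[of u 1 m u' 1] by simp
  then show "g \<otimes>\<^bsub>affine_group m c\<^esub> h \<in> carrier (affine_group m c)"
    by (simp add: mult_affine_group affine_group_closed_mod)
next
  fix g h k :: "int \<times> int"
  obtain u v u' v' u'' v'' where g: "g = (u, v)" "h = (u', v')" "k = (u'', v'')"
    by (cases g, cases h, cases k)
  show "g \<otimes>\<^bsub>affine_group m c\<^esub> h \<otimes>\<^bsub>affine_group m c\<^esub> k =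
      g \<otimes>\<^bsub>affine_group m c\<^esub> (h \<otimes>\<^bsub>affine_group m c\<^esub> k)"
  proof -
    have "[(u * u' mod m ^ c) * u'' = (u * u') * u''] (mod m ^ c)"
      "[u * (u' * u'' mod m ^ c) = u * (u' * u'')] (mod m ^ c)"
      "[(v + u * v') mod m ^ c + (u * u' mod m ^ c) * v'' = (v + u * v') + (u * u') * v''] (mod m ^ c)"
      "[v + u * ((v' + u' * v'') mod m ^ c) = v + u * (v' + u' * v'')] (mod m ^ c)"
      by (intro cong_add cong_mult cong_refl; simp add: cong_def)+
    then show ?thesis
      unfolding g mult_affine_group cong_def by (simp add: distrib_left add.assoc mult.assoc)
  qed
next
  fix g assume g: "g \<in> carrier (affine_group m c)"
  obtain u v where [simp]: "g = (u, v)" by (cases g)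
  have "0 \<le> u" "u < m ^ c" "0 \<le> v" "v < m ^ c" using g by (auto simp: affine_group_def)
  then show "\<one>\<^bsub>affine_group m c\<^esub> \<otimes>\<^bsub>affine_group m c\<^esub> g = g"
    by (simp add: one_affine_group mult_affine_group mod_simps)
next
  fix g assume g: "g \<in> carrier (affine_group m c)"
  obtain u v where [simp]: "g = (u, v)" by (cases g)
  have u: "[u = 1] (mod m)" using g by (auto simp: affine_group_def)
  define w where "w = modular_inverse (m ^ c) u"
  have w: "[w * u = 1] (mod m ^ c)"
    unfolding w_def by (intro cong_modular_inverse2 coprime_power_of_cong_1 u)
  then have "[w * u = 1] (mod m)" by (rule cong_dvd_modulus) (rule m_dvd_power)
  moreover have "[w * u = w * 1] (mod m)" using u by (rule cong_scalar_left)
  ultimately have "[w = 1] (mod m)" by (simp add: cong_def)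
  then have "(w mod m ^ c, (- w * v) mod m ^ c) \<in> carrier (affine_group m c)"
    by (simp only: affine_group_closed_mod)
  moreover have "(w mod m ^ c, (- w * v) mod m ^ c) \<otimes>\<^bsub>affine_group m c\<^esub> g = \<one>\<^bsub>affine_group m c\<^esub>"
  proof -
    have "[(- w * v) mod m ^ c + (w mod m ^ c) * v = - w * v + w * v] (mod m ^ c)"
      by (intro cong_add cong_mult cong_refl; simp add: cong_def)
    then show ?thesis using w by (simp add: mult_affine_group one_affine_group mod_simps cong_def)
  qed
  ultimately show "\<exists>h\<in>carrier (affine_group m c). h \<otimes>\<^bsub>affine_group m c\<^esub> g = \<one>\<^bsub>affine_group m c\<^esub>"
    by blast
qed

interpretation A: group "affine_group m c" by (rule group_affine_group)

text \<open>
  Upper bounds for the lower central series: \<open>affine_level k\<close> contains the term with index \<open>k + 1\<close>.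
  The bound on \<open>u\<close> holds at level \<open>0\<close> by definition of the group and is needed with exponent \<open>k + 1\<close>,
  one more than for \<open>v\<close>, in the commutator computation; the minimum with \<open>c\<close> keeps the modulus a
  divisor of \<open>m\<^sup>c\<close>.
\<close>

definition affine_level :: "nat \<Rightarrow> (int \<times> int) set" where
  "affine_level k = {(u, v) \<in> carrier (affine_group m c).
    [u = 1] (mod m ^ min c (k + 1)) \<and> m ^ k dvd v}"

lemma affine_level_subgroup:
  assumes k: "k \<le> c"
  shows "subgroup (affine_level k) (affine_group m c)"
proof (rule A.subgroupI)
  have d: "m ^ min c (k + 1) dvd m ^ c" "m ^ k dvd m ^ c" using k by (auto intro: le_imp_power_dvd)
  show "affine_level k \<subseteq> carrier (affine_group m c)" by (auto simp: affine_level_def)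
  have "\<one>\<^bsub>affine_group m c\<^esub> \<in> affine_level k"
    using A.one_closed cong_mod_power[OF d(1), of 1 1]
    by (simp add: affine_level_def one_affine_group)
  then show "affine_level k \<noteq> {}" by blast
  fix g assume g: "g \<in> affine_level k"
  then have gc: "g \<in> carrier (affine_group m c)" by (auto simp: affine_level_def)
  obtain u v where gu: "g = (u, v)" by (cases g)
  have u: "[u = 1] (mod m ^ min c (k + 1))" "m ^ k dvd v" "[u = 1] (mod m)"
    using g by (auto simp: gu affine_level_def affine_group_def)
  {
    obtain u' v' where i: "inv\<^bsub>affine_group m c\<^esub> g = (u', v')" by force
    have e: "[u * u' = 1] (mod m ^ c)" "m ^ c dvd v + u * v'"
      using A.r_inv[OF gc, unfolded i, unfolded gu]
      by (auto simp: mult_affine_group one_affine_group cong_def)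
    have "[u * u' = 1] (mod m ^ min c (k + 1))" using e(1) d(1) by (rule cong_dvd_modulus)
    moreover have "[u * u' = 1 * u'] (mod m ^ min c (k + 1))" using u(1) by (rule cong_scalar_right)
    ultimately have "[u' = 1] (mod m ^ min c (k + 1))" by (simp add: cong_def)
    moreover have "m ^ k dvd v + u * v'" using d(2) e(2) by (rule dvd_trans)
    then have "m ^ k dvd u * v'" using u(2) by (simp add: dvd_add_right_iff)
    then have "m ^ k dvd v'"
      using coprime_power_of_cong_1[OF u(3), of k] by (simp add: coprime_dvd_mult_right_iff coprime_commute)
    ultimately show "inv\<^bsub>affine_group m c\<^esub> g \<in> affine_level k"
      using A.inv_closed[OF gc] by (simp add: affine_level_def i)
  next
    fix h assume h: "h \<in> affine_level k"
    then have hc: "h \<in> carrier (affine_group m c)" by (auto simp: affine_level_def)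
    obtain u' v' where hu: "h = (u', v')" by (cases h)
    have u': "[u' = 1] (mod m ^ min c (k + 1))" "m ^ k dvd v'"
      using h by (auto simp: hu affine_level_def)
    have "[u * u' = 1] (mod m ^ min c (k + 1))" using cong_mult[OF u(1) u'(1)] by simp
    then have "[u * u' mod m ^ c = 1] (mod m ^ min c (k + 1))" by (simp only: cong_mod_power[OF d(1)])
    then show "g \<otimes>\<^bsub>affine_group m c\<^esub> h \<in> affine_level k"
      using A.m_closed[OF gc hc] u(2) u'(2)
      by (simp add: gu hu affine_level_def mult_affine_group dvd_mod_iff[OF d(2)])
  }
qed

text \<open>
  The commutator of \<open>(u, v)\<close> and \<open>(u', v')\<close> is the translation by \<open>(1 - u') v + (u - 1) v'\<close>.
  Both terms are divisible by \<open>m ^ (k + 1)\<close>: in the first, \<open>m\<close> divides \<open>1 - u'\<close> and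
  \<open>m ^ k\<close> divides \<open>v\<close>; in the second, \<open>m ^ (k + 1)\<close> divides \<open>u - 1\<close>.
\<close>

lemma affine_level_commutator:
  assumes k: "k < c" and g: "g \<in> affine_level k" and h: "h \<in> carrier (affine_group m c)"
  shows "g \<otimes>\<^bsub>affine_group m c\<^esub> h \<otimes>\<^bsub>affine_group m c\<^esub> inv\<^bsub>affine_group m c\<^esub> g
    \<otimes>\<^bsub>affine_group m c\<^esub> inv\<^bsub>affine_group m c\<^esub> h \<in> affine_level (Suc k)"
    (is "?C \<in> _")
proof -
  have d: "m ^ Suc k dvd m ^ c" using k by (intro le_imp_power_dvd) simp
  have gc: "g \<in> carrier (affine_group m c)" using g by (auto simp: affine_level_def)
  obtain u v u' v' where gh: "g = (u, v)" "h = (u', v')" by (cases g, cases h)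
  have min: "min c (k + 1) = Suc k" using k by simp
  have u: "[u = 1] (mod m ^ Suc k)" "m ^ k dvd v" "[u = 1] (mod m)" "[u' = 1] (mod m)"
    using g h min by (auto simp: gh affine_level_def affine_group_def)
  obtain w z where C: "?C = (w, z)" by force
  have Cc: "?C \<in> carrier (affine_group m c)" using gc h by simp
  have "?C \<otimes>\<^bsub>affine_group m c\<^esub> (h \<otimes>\<^bsub>affine_group m c\<^esub> g) = g \<otimes>\<^bsub>affine_group m c\<^esub> h"
    using gc h by (simp add: A.m_assoc A.inv_solve_left) (simp add: A.inv_solve_left flip: A.m_assoc)
  then have eq: "(w, z) \<otimes>\<^bsub>affine_group m c\<^esub> ((u', v') \<otimes>\<^bsub>affine_group m c\<^esub> (u, v)) =
      (u, v) \<otimes>\<^bsub>affine_group m c\<^esub> (u', v')"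
    unfolding C unfolding gh .
  then have w: "[w * (u' * u) = u * u'] (mod m ^ c)"
    by (auto simp: mult_affine_group cong_def mod_simps)
  have "[z + w * (v' + u' * v) = z + w * ((v' + u' * v) mod m ^ c)] (mod m ^ c)"
    by (intro cong_add cong_mult cong_refl; simp add: cong_def)
  also have "[z + w * ((v' + u' * v) mod m ^ c) = v + u * v'] (mod m ^ c)"
    using eq by (simp add: mult_affine_group cong_def)
  finally have z: "[z + w * (v' + u' * v) = v + u * v'] (mod m ^ c)" .
  have "coprime (u' * u) (m ^ c)" 
    using coprime_power_of_cong_1[OF u(3), of c] coprime_power_of_cong_1[OF u(4), of c] by auto
  moreover have "[w * (u' * u) = 1 * (u' * u)] (mod m ^ c)" using w by (simp add: mult.commute)
  ultimately have w1: "[w = 1] (mod m ^ c)" using cong_mult_rcancel by blast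
  have "[z + (v' + u' * v) = z + w * (v' + u' * v)] (mod m ^ c)"
    using cong_scalar_right[OF w1, of "v' + u' * v"] by (intro cong_add) (simp_all add: cong_sym_eq)
  then have "[z + (v' + u' * v) = v + u * v'] (mod m ^ c)" using z by (rule cong_trans)
  then have "m ^ c dvd z + (v' + u' * v) - (v + u * v')" by (simp add: cong_iff_dvd_diff)
  then have "m ^ Suc k dvd z + (v' + u' * v) - (v + u * v')" using d by (rule dvd_trans[rotated])
  moreover have "m ^ Suc k dvd (u - 1) * v'" using u(1) by (simp add: cong_iff_dvd_diff)
  moreover have "m ^ Suc k dvd (u' - 1) * v"
    using u(2,4) by (simp add: cong_iff_dvd_diff mult_dvd_mono)
  ultimately have "m ^ Suc k dvd (z + (v' + u' * v) - (v + u * v')) + (u - 1) * v' - (u' - 1) * v"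
    by (rule dvd_diff[OF dvd_add])
  then have "m ^ Suc k dvd z" by (simp add: algebra_simps)
  moreover have "[w = 1] (mod m ^ min c (Suc k + 1))"
    using w1 by (rule cong_dvd_modulus) (simp add: le_imp_power_dvd)
  ultimately show ?thesis using Cc by (simp add: affine_level_def C)
qed

lemma lower_central_affine_level:
  "k \<le> c \<Longrightarrow> lower_central (affine_group m c) (k + 1) \<subseteq> affine_level k"
proof (induction k)
  case 0
  then show ?case using c_pos by (auto simp: affine_level_def affine_group_def min_def)
next
  case (Suc k)
  then have IH: "lower_central (affine_group m c) (Suc k) \<subseteq> affine_level k" by simp
  have "{g \<otimes>\<^bsub>affine_group m c\<^esub> h \<otimes>\<^bsub>affine_group m c\<^esub> inv\<^bsub>affine_group m c\<^esub> g
        \<otimes>\<^bsub>affine_group m c\<^esub> inv\<^bsub>affine_group m c\<^esub> h | g h.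
        g \<in> lower_central (affine_group m c) (Suc k) \<and> h \<in> carrier (affine_group m c)}
      \<subseteq> affine_level (Suc k)" (is "?C \<subseteq> _")
  proof
    fix z assume "z \<in> ?C"
    then obtain g h where "g \<in> lower_central (affine_group m c) (Suc k)" "h \<in> carrier (affine_group m c)"
      and z: "z = g \<otimes>\<^bsub>affine_group m c\<^esub> h \<otimes>\<^bsub>affine_group m c\<^esub> inv\<^bsub>affine_group m c\<^esub> g
        \<otimes>\<^bsub>affine_group m c\<^esub> inv\<^bsub>affine_group m c\<^esub> h" by blast
    then show "z \<in> affine_level (Suc k)"
      unfolding z using IH Suc.prems by (intro affine_level_commutator) auto
  qed
  then show ?case
    using A.generate_subgroup_incl[OF _ affine_level_subgroup[OF Suc.prems]]
    by (simp add: commutator_subgroup_def)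
qed

lemma lower_central_affine_group:
  "lower_central (affine_group m c) (c + 1) \<subseteq> {\<one>\<^bsub>affine_group m c\<^esub>}"
proof
  fix g assume "g \<in> lower_central (affine_group m c) (c + 1)"
  then have g: "g \<in> affine_level c" using lower_central_affine_level[of c] by auto
  obtain u v where uv: "g = (u, v)" by (cases g)
  have "0 \<le> u" "u < m ^ c" "0 \<le> v" "v < m ^ c"
    using g by (auto simp: uv affine_level_def affine_group_def)
  then have "u = u mod m ^ c" "v = v mod m ^ c" by simp_all
  moreover have "[u = 1] (mod m ^ c)" "m ^ c dvd v"
    using g by (simp_all add: uv affine_level_def)
  then have "u mod m ^ c = 1 mod m ^ c" "v mod m ^ c = 0"
    by (simp_all add: cong_def)
  ultimately show "g \<in> {\<one>\<^bsub>affine_group m c\<^esub>}" by (simp add: uv one_affine_group)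
qed

lemma affine_translation_pow:
  "(1 mod m ^ c, 1 mod m ^ c) [^]\<^bsub>affine_group m c\<^esub> (k::nat) = (1 mod m ^ c, int k mod m ^ c)"
proof (induction k)
  case 0
  show ?case by (simp add: one_affine_group)
next
  case (Suc k)
  have "[int k mod m ^ c + (1 mod m ^ c) * (1 mod m ^ c) = int k + 1 * 1] (mod m ^ c)"
    by (intro cong_add cong_mult; simp add: cong_def)
  with Suc show ?case by (simp add: mult_affine_group mod_simps cong_def add.commute)
qed

end


section \<open>The nilpotent quotients of \<open>Gamma\<close>\<close>

lemma (in comm_group) lower_central_trivial:
  assumes "k \<ge> 1"
  shows "lower_central G (k + 1) \<subseteq> {\<one>}"
  unfolding lower_central_step[OF assms] commutator_subgroup_def
proof (rule generate_subgroup_incl[OF _ triv_subgroup], clarify)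
  fix g h assume "g \<in> lower_central G k" and h: "h \<in> carrier G"
  then have g: "g \<in> carrier G" using lower_central_subset by auto
  have "g \<otimes> h \<otimes> inv g \<otimes> inv h = (g \<otimes> h) \<otimes> inv (h \<otimes> g)"
    using g h by (simp add: inv_mult_group m_assoc)
  then show "g \<otimes> h \<otimes> inv g \<otimes> inv h = \<one>" using g h by (simp add: m_comm[of g h])
qed

text \<open>
  In the quotient by \<open>H\<close> the order of \<open>b\<close> divides every \<open>d\<^sub>i\<close>, hence their greatest common divisor.
\<close>

lemma (in normal) pow_Gcd_mem:
  assumes b: "b \<in> carrier G" and "\<And>i. b [^] (d i :: nat) \<in> H"
  shows "b [^] Gcd (range d) \<in> H"
proof -
  interpret Q: group "G Mod H" by (rule factorgroup_is_group)
  have c: "H #> b \<in> carrier (G Mod H)" using b by (simp add: carrier_FactGroup)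
  have iff: "b [^] k \<in> H \<longleftrightarrow> Q.ord (H #> b) dvd k" for k :: nat
  proof -
    have "(H #> b) [^]\<^bsub>G Mod H\<^esub> k = H #> b [^] k" using b by (rule FactGroup_pow)
    moreover have "H #> b [^] k = H \<longleftrightarrow> b [^] k \<in> H"
      using coset_join1[of H] coset_join2[of _ H] b subgroup_axioms by blast
    ultimately show ?thesis using Q.pow_eq_id[OF c, of k] by simp
  qed
  have "Q.ord (H #> b) dvd Gcd (range d)" using assms(2) by (auto simp: iff intro!: Gcd_greatest)
  then show ?thesis by (simp add: iff)
qed

lemma (in group) conj_pow_commutator:
  assumes A: "A \<subseteq> carrier G" and b: "b \<in> A" and t: "t \<in> carrier G"
    and conj: "t \<otimes> b \<otimes> inv t = b [^] k" and k: "k \<ge> (1::nat)"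
  shows "b [^] (k - 1) \<in> commutator_subgroup G A (carrier G)"
proof -
  have bc: "b \<in> carrier G" using A b by auto
  let ?C = "{h \<otimes> k \<otimes> inv h \<otimes> inv k | h k. h \<in> A \<and> k \<in> carrier G}"
  have sub: "subgroup (commutator_subgroup G A (carrier G)) G"
    unfolding commutator_subgroup_def using A by (intro generate_is_subgroup) (auto simp: subset_iff)
  have "b [^] k = b [^] (k - 1) \<otimes> b" using k by (metis Suc_diff_1 less_le_trans zero_less_one nat_pow_Suc)
  then have "b [^] (k - 1) = t \<otimes> b \<otimes> inv t \<otimes> inv b"
    using bc conj by (metis inv_solve_right nat_pow_closed)
  also have "\<dots> = inv (b \<otimes> t \<otimes> inv b \<otimes> inv t)"
    using bc t by (simp add: inv_mult_group m_assoc)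
  also have "\<dots> \<in> commutator_subgroup G A (carrier G)"
    using b t by (intro subgroup.m_inv_closed[OF sub]) (auto simp: commutator_subgroup_def intro!: generate.incl)
  finally show ?thesis .
qed

definition Gamma_gen :: "('r \<Rightarrow> nat) \<Rightarrow> ('r \<Rightarrow> nat) \<Rightarrow> 'r gen \<Rightarrow> 'r gen word set" where
  "Gamma_gen p y g = word_class (Gamma_rels p y) [(g, True)]"

lemma group_Gamma: "group (Gamma p y)"
  by (simp add: Gamma_def group_presented_group)

lemma Gamma_gen_closed: "Gamma_gen p y g \<in> carrier (Gamma p y)"
  by (simp add: Gamma_def Gamma_gen_def)

lemma Gamma_relations:
  shows "Gamma_gen p y (Gen_t i) \<otimes>\<^bsub>Gamma p y\<^esub> Gamma_gen p y (Gen_t j) =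
      Gamma_gen p y (Gen_t j) \<otimes>\<^bsub>Gamma p y\<^esub> Gamma_gen p y (Gen_t i)" (is ?commute)
    and "Gamma_gen p y (Gen_t i) \<otimes>\<^bsub>Gamma p y\<^esub> Gamma_gen p y Gen_a
        \<otimes>\<^bsub>Gamma p y\<^esub> inv\<^bsub>Gamma p y\<^esub> Gamma_gen p y (Gen_t i) =
      Gamma_gen p y Gen_a [^]\<^bsub>Gamma p y\<^esub> (p i ^ y i)" (is ?conj)
proof -
  interpret group "Gamma p y" by (rule group_Gamma)
  have cl: "range (Gamma_gen p y) \<subseteq> carrier (Gamma p y)" using Gamma_gen_closed by auto
  have rel: "word_eval (Gamma p y) (Gamma_gen p y) l = word_eval (Gamma p y) (Gamma_gen p y) r"
    if "(l, r) \<in> Gamma_rels p y" for l r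
    using presented_group_relation[OF that] unfolding Gamma_def Gamma_gen_def[abs_def] .
  show ?commute
  proof (cases "i = j")
    case False
    then have "([(Gen_t i, True), (Gen_t j, True)], [(Gen_t j, True), (Gen_t i, True)]) \<in> Gamma_rels p y"
      by (auto simp: Gamma_rels_def)
    from rel[OF this] show ?thesis by (simp add: Gamma_gen_closed)
  qed simp
  have "([(Gen_t i, True), (Gen_a, True), (Gen_t i, False)], replicate (p i ^ y i) (Gen_a, True))
      \<in> Gamma_rels p y"
    by (auto simp: Gamma_rels_def)
  from rel[OF this] show ?conj
    by (simp add: word_eval_replicate[OF cl] Gamma_gen_closed m_assoc)
qed

lemma Gamma_universal:
  assumes "group H" and a: "a \<in> carrier H" and t: "\<And>i. t i \<in> carrier H"
    and comm: "\<And>i j. t i \<otimes>\<^bsub>H\<^esub> t j = t j \<otimes>\<^bsub>H\<^esub> t i"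
    and conj: "\<And>i. t i \<otimes>\<^bsub>H\<^esub> a \<otimes>\<^bsub>H\<^esub> inv\<^bsub>H\<^esub> t i = a [^]\<^bsub>H\<^esub> (p i ^ y i)"
  obtains h where "h \<in> hom (Gamma p y) H"
    "h (Gamma_gen p y Gen_a) = a" "\<And>i. h (Gamma_gen p y (Gen_t i)) = t i"
proof -
  interpret H: group H by fact
  define f where "f g = (case g of Gen_a \<Rightarrow> a | Gen_t i \<Rightarrow> t i)" for g
  have f [simp]: "f Gen_a = a" "f (Gen_t i) = t i" for i by (auto simp: f_def)
  have "f g \<in> carrier H" for g by (cases g) (auto simp: a t)
  then have cl: "range f \<subseteq> carrier H" by auto
  have "word_eval H f l = word_eval H f r" if "(l, r) \<in> Gamma_rels p y" for l r
    using that comm conj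
    by (auto simp: Gamma_rels_def H.word_eval_replicate[OF cl] a t H.m_assoc)
  from H.presented_group_universal[OF cl this] obtain h where
    "h \<in> hom (presented_group (Gamma_rels p y)) H"
    "\<And>w. h (word_class (Gamma_rels p y) w) = word_eval H f w" by blast
  then show ?thesis
    using that[of h] by (simp add: Gamma_def Gamma_gen_def a t)
qed

definition Gamma_nil_x :: "('r \<Rightarrow> nat) \<Rightarrow> ('r \<Rightarrow> nat) \<Rightarrow> nat \<Rightarrow> 'r gen word set set" where
  "Gamma_nil_x p y c = lower_central (Gamma p y) (c + 1) #>\<^bsub>Gamma p y\<^esub> Gamma_gen p y Gen_a"

lemma Gamma_nil_s_eq:
  "Gamma_nil_s p y c i = lower_central (Gamma p y) (c + 1) #>\<^bsub>Gamma p y\<^esub> Gamma_gen p y (Gen_t i)"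
  by (simp add: Gamma_nil_s_def Gamma_gen_def)

lemma Gamma_nil_projection:
  "group_hom (Gamma p y) (Gamma_nil p y c) (\<lambda>g. lower_central (Gamma p y) (c + 1) #>\<^bsub>Gamma p y\<^esub> g)"
proof -
  interpret group "Gamma p y" by (rule group_Gamma)
  interpret N: normal "lower_central (Gamma p y) (c + 1)" "Gamma p y" by (rule lower_central_normal)
  show ?thesis unfolding Gamma_nil_def
    by (intro group_hom.intro group_hom_axioms.intro N.factorgroup_is_group N.r_coset_hom_Mod is_group)
qed

text \<open>
  A homomorphism from \<open>Gamma\<close> maps the term of index \<open>c + 1\<close> of the lower central series into that of the
  target, which is trivial, so it factors through the nilpotent quotient.
\<close>

lemma Gamma_nil_universal:
  assumes "group H" and nilpotent: "lower_central H (c + 1) \<subseteq> {\<one>\<^bsub>H\<^esub>}"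
    and a: "a \<in> carrier H" and t: "\<And>i. t i \<in> carrier H"
    and comm: "\<And>i j. t i \<otimes>\<^bsub>H\<^esub> t j = t j \<otimes>\<^bsub>H\<^esub> t i"
    and conj: "\<And>i. t i \<otimes>\<^bsub>H\<^esub> a \<otimes>\<^bsub>H\<^esub> inv\<^bsub>H\<^esub> t i = a [^]\<^bsub>H\<^esub> (p i ^ y i)"
  obtains h where "h \<in> hom (Gamma_nil p y c) H"
    "h (Gamma_nil_x p y c) = a" "\<And>i. h (Gamma_nil_s p y c i) = t i"
proof -
  obtain f where f: "f \<in> hom (Gamma p y) H"
    "f (Gamma_gen p y Gen_a) = a" "\<And>i. f (Gamma_gen p y (Gen_t i)) = t i"
    by (rule Gamma_universal[where p = p and y = y, OF assms(1) a t comm conj]) blast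
  interpret group_hom "Gamma p y" H f
    by (intro group_hom.intro group_hom_axioms.intro f group_Gamma assms)
  have "lower_central (Gamma p y) (c + 1) \<subseteq> kernel (Gamma p y) H f"
    using lower_central_image_subset[of "c + 1"] nilpotent G.lower_central_subset[of "c + 1"]
    by (auto simp: kernel_def simp del: lower_central.simps)
  from FactGroup_universal_kernel[OF G.lower_central_normal this]
  obtain h where "h \<in> hom (Gamma_nil p y c) H"
    "\<And>g. g \<in> carrier (Gamma p y) \<Longrightarrow> h (lower_central (Gamma p y) (c + 1) #>\<^bsub>Gamma p y\<^esub> g) = f g"
    unfolding Gamma_nil_def by blast
  then show ?thesis
    using that[of h] f by (simp add: Gamma_nil_x_def Gamma_nil_s_eq Gamma_gen_closed)
qed

text \<open>
  If \<open>b = a ^ m ^ k\<close> lies in the term with index \<open>k + 1\<close>, then the next term contains its commutators with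
  the \<open>t\<^sub>i\<close>, which are \<open>b ^ (q\<^sub>i - 1)\<close> up to inversion, and therefore also \<open>b ^ m\<close>.
\<close>

lemma Gamma_pow_lower_central:
  assumes pos: "\<And>i. p i ^ y i \<ge> 1" and m: "m = Gcd (range (\<lambda>i. p i ^ y i - 1))"
  shows "Gamma_gen p y Gen_a [^]\<^bsub>Gamma p y\<^esub> (m ^ k) \<in> lower_central (Gamma p y) (k + 1)"
proof (induction k)
  case 0
  interpret group "Gamma p y" by (rule group_Gamma)
  show ?case by (simp add: Gamma_gen_closed)
next
  case (Suc k)
  interpret group "Gamma p y" by (rule group_Gamma)
  interpret N: normal "lower_central (Gamma p y) (Suc k + 1)" "Gamma p y" by (rule lower_central_normal)
  let ?b = "Gamma_gen p y Gen_a [^]\<^bsub>Gamma p y\<^esub> (m ^ k)"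
  have b: "?b \<in> carrier (Gamma p y)" by (simp add: Gamma_gen_closed)
  have "?b [^]\<^bsub>Gamma p y\<^esub> (p i ^ y i - 1) \<in> lower_central (Gamma p y) (Suc k + 1)" for i
  proof -
    let ?t = "Gamma_gen p y (Gen_t i)"
    have t: "?t \<in> carrier (Gamma p y)" by (simp add: Gamma_gen_closed)
    have "(\<lambda>h. ?t \<otimes>\<^bsub>Gamma p y\<^esub> h \<otimes>\<^bsub>Gamma p y\<^esub> inv\<^bsub>Gamma p y\<^esub> ?t) \<in> hom (Gamma p y) (Gamma p y)"
      using t by (intro homI) (auto simp: m_assoc inv_solve_left)
    from hom_nat_pow[OF this _ is_group is_group, of "Gamma_gen p y Gen_a" "m ^ k"]
    have conj: "?t \<otimes>\<^bsub>Gamma p y\<^esub> ?b \<otimes>\<^bsub>Gamma p y\<^esub> inv\<^bsub>Gamma p y\<^esub> ?t = ?b [^]\<^bsub>Gamma p y\<^esub> (p i ^ y i)"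
      by (simp add: Gamma_gen_closed Gamma_relations nat_pow_pow mult.commute)
    show ?thesis
      using conj_pow_commutator[OF lower_central_subset Suc t conj pos] by simp
  qed
  from N.pow_Gcd_mem[where d = "\<lambda>i. p i ^ y i - 1", OF b this, folded m] show ?case
    by (simp add: nat_pow_pow Gamma_gen_closed mult.commute del: lower_central.simps)
qed

lemma Gamma_nil_cyclic_by_free_abelian:
  fixes p y :: "'r::finite \<Rightarrow> nat"
  assumes gt1: "\<And>i. p i ^ y i > 1" and m: "m = Gcd (range (\<lambda>i. p i ^ y i - 1))" and c: "c \<ge> 1"
  shows "\<exists>\<sigma>. cyclic_by_free_abelian (Gamma_nil p y c) (Gamma_nil_x p y c) (Gamma_nil_s p y c)
    (\<lambda>i. int (p i ^ y i)) (int (m ^ c)) \<sigma>"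
proof -
  let ?\<Gamma> = "Gamma p y" let ?Q = "Gamma_nil p y c" let ?x = "Gamma_nil_x p y c"
  let ?s = "Gamma_nil_s p y c" let ?L = "lower_central (Gamma p y) (c + 1)"
  interpret pr: group_hom ?\<Gamma> ?Q "\<lambda>g. ?L #>\<^bsub>?\<Gamma>\<^esub> g" by (rule Gamma_nil_projection)
  have x: "?x \<in> carrier ?Q" unfolding Gamma_nil_x_def by (intro pr.hom_closed Gamma_gen_closed)
  have s: "?s i \<in> carrier ?Q" for i unfolding Gamma_nil_s_eq by (intro pr.hom_closed Gamma_gen_closed)
  have s_comm: "?s i \<otimes>\<^bsub>?Q\<^esub> ?s j = ?s j \<otimes>\<^bsub>?Q\<^esub> ?s i" for i j
    unfolding Gamma_nil_s_eq by (metis Gamma_relations(1) Gamma_gen_closed pr.hom_mult)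
  have s_conj: "?s i \<otimes>\<^bsub>?Q\<^esub> ?x \<otimes>\<^bsub>?Q\<^esub> inv\<^bsub>?Q\<^esub> ?s i = ?x [^]\<^bsub>?Q\<^esub> (p i ^ y i)" for i
    unfolding Gamma_nil_s_eq Gamma_nil_x_def
    by (metis Gamma_relations(2) Gamma_gen_closed pr.hom_mult pr.hom_inv pr.hom_nat_pow
        pr.G.inv_closed pr.G.m_closed)
  have nilpotent: "lower_central ?Q (c + 1) \<subseteq> {\<one>\<^bsub>?Q\<^esub>}"
    using pr.G.lower_central_quotient[of "c + 1"] by (simp add: Gamma_nil_def del: lower_central.simps)
  have mpos: "m > 0"
  proof -
    obtain i :: 'r where True by simp
    have "m dvd p i ^ y i - 1" unfolding m by (rule Gcd_dvd) blast
    then show ?thesis using gt1[of i] by (auto intro!: Nat.gr0I)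
  qed
  have q_cong: "[int (p i ^ y i) = 1] (mod int m)" for i
  proof -
    have "m dvd p i ^ y i - 1" unfolding m by (rule Gcd_dvd) blast
    then have "int m dvd int (p i ^ y i - 1)" by (simp only: of_nat_dvd_iff)
    then show ?thesis using gt1[of i] by (simp add: cong_iff_dvd_diff of_nat_diff)
  qed

  \<comment> \<open>The exponent of \<open>s\<^sub>j\<close>, from the universal property with target \<open>\<int>\<close>.\<close>
  have "\<exists>\<sigma>. \<sigma> \<in> hom ?Q integer_group \<and> \<sigma> ?x = 0 \<and> (\<forall>i. \<sigma> (?s i) = (if i = j then 1 else 0))" for j
  proof -
    obtain f where "f \<in> hom ?Q integer_group" "f ?x = 0" "\<And>i. f (?s i) = (if i = j then 1 else 0)"
      by (rule Gamma_nil_universal[of integer_group c 0 "\<lambda>i. if i = j then 1 else 0" p y])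
         (use comm_group.lower_central_trivial[OF abelian_integer_group c] in \<open>auto simp del: lower_central.simps\<close>)
    then show ?thesis by auto
  qed
  then obtain \<sigma> where \<sigma>: "\<And>j. \<sigma> j \<in> hom ?Q integer_group" "\<And>j. \<sigma> j ?x = 0"
    "\<And>i j. \<sigma> j (?s i) = (if i = j then 1 else 0)" by metis

  \<comment> \<open>The affine model gives the lower bound for the order of \<open>x\<close>: there \<open>x\<close> is the translation by \<open>1\<close>.\<close>
  have pow_dvd: "m ^ c dvd k" if k: "?x [^]\<^bsub>?Q\<^esub> (k::nat) = \<one>\<^bsub>?Q\<^esub>" for k
  proof -
    let ?A = "affine_group (int m) c"
    let ?a = "(1 mod int m ^ c, 1 mod int m ^ c)"
    let ?t = "\<lambda>i. (int (p i ^ y i) mod int m ^ c, 0 mod int m ^ c)"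
    have mc: "int m > 0" "c \<ge> 1" using mpos c by auto
    interpret A: group ?A by (rule group_affine_group[OF mc])
    have a: "?a \<in> carrier ?A" and t: "?t i \<in> carrier ?A" for i
      using q_cong[of i] by (simp_all only: affine_group_closed_mod[OF mc] cong_refl)
    obtain h where h: "h \<in> hom ?Q ?A" "h ?x = ?a" "\<And>i. h (?s i) = ?t i"
    proof (rule Gamma_nil_universal[of ?A c ?a ?t p y])
      show "lower_central ?A (c + 1) \<subseteq> {\<one>\<^bsub>?A\<^esub>}" by (rule lower_central_affine_group[OF mc])
      show "?t i \<otimes>\<^bsub>?A\<^esub> ?t j = ?t j \<otimes>\<^bsub>?A\<^esub> ?t i" for i j
        by (simp add: mult_affine_group[OF mc] mult.commute)
      show "?t i \<otimes>\<^bsub>?A\<^esub> ?a \<otimes>\<^bsub>?A\<^esub> inv\<^bsub>?A\<^esub> ?t i = ?a [^]\<^bsub>?A\<^esub> (p i ^ y i)" for i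
      proof -
        have "?t i \<otimes>\<^bsub>?A\<^esub> ?a = ?a [^]\<^bsub>?A\<^esub> (p i ^ y i) \<otimes>\<^bsub>?A\<^esub> ?t i"
          by (simp add: affine_translation_pow[OF mc] mult_affine_group[OF mc] mod_simps)
        then show ?thesis using a t[of i] A.inv_solve_right' A.nat_pow_closed A.m_closed by metis
      qed
    qed (use a t A.is_group in auto)
    have "?a [^]\<^bsub>?A\<^esub> k = \<one>\<^bsub>?A\<^esub>"
      using hom_nat_pow[OF h(1) x pr.H.is_group A.is_group, of k] h(2) k
        hom_one[OF h(1) pr.H.is_group A.is_group] by simp
    then have "int k mod int m ^ c = 0"
      by (simp add: affine_translation_pow[OF mc] one_affine_group[OF mc])
    then have "int (m ^ c) dvd int k" by (simp add: mod_eq_0_iff_dvd)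
    then show ?thesis by (simp only: of_nat_dvd_iff)
  qed
  have "?x [^]\<^bsub>?Q\<^esub> (m ^ c) = \<one>\<^bsub>?Q\<^esub>"
  proof -
    have "?L #>\<^bsub>?\<Gamma>\<^esub> (Gamma_gen p y Gen_a [^]\<^bsub>?\<Gamma>\<^esub> (m ^ c)) = ?L"
      using pr.G.coset_join2[OF _ normal_imp_subgroup[OF pr.G.lower_central_normal]
          Gamma_pow_lower_central[OF less_imp_le[OF gt1] m]]
      by (simp add: Gamma_gen_closed del: lower_central.simps)
    moreover have "?x [^]\<^bsub>?Q\<^esub> (m ^ c) = ?L #>\<^bsub>?\<Gamma>\<^esub> (Gamma_gen p y Gen_a [^]\<^bsub>?\<Gamma>\<^esub> (m ^ c))"
      unfolding Gamma_nil_x_def by (rule pr.hom_nat_pow[OF Gamma_gen_closed, symmetric])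
    ultimately show ?thesis by (simp add: Gamma_nil_def del: lower_central.simps)
  qed
  then have "?x [^]\<^bsub>?Q\<^esub> k = \<one>\<^bsub>?Q\<^esub> \<longleftrightarrow> m ^ c dvd k" for k :: nat
    using pow_dvd by (auto elim!: dvdE simp: x simp flip: pr.H.nat_pow_pow)
  then have ord: "pr.H.ord ?x = m ^ c" using pr.H.ord_unique[OF x] by blast

  have gen_carrier: "generate ?Q (insert ?x (range ?s)) = carrier ?Q"
  proof -
    have "generate ?\<Gamma> (range (Gamma_gen p y)) = carrier ?\<Gamma>"
      unfolding Gamma_def Gamma_gen_def[abs_def]
      by (intro presented_group_generated group.generate_is_subgroup group_presented_group)
         (auto intro: generate.incl)
    moreover have "range (Gamma_gen p y) \<subseteq> carrier ?\<Gamma>" using Gamma_gen_closed by auto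
    ultimately have "generate ?Q ((\<lambda>g. ?L #>\<^bsub>?\<Gamma>\<^esub> g) ` range (Gamma_gen p y)) = (\<lambda>g. ?L #>\<^bsub>?\<Gamma>\<^esub> g) ` carrier ?\<Gamma>"
      using pr.generate_img by metis
    moreover have "(\<lambda>g. ?L #>\<^bsub>?\<Gamma>\<^esub> g) ` carrier ?\<Gamma> = carrier ?Q"
      by (simp add: Gamma_nil_def carrier_FactGroup del: lower_central.simps)
    moreover have "range (Gamma_gen p y) = insert (Gamma_gen p y Gen_a) (range (\<lambda>i. Gamma_gen p y (Gen_t i)))"
    proof -
      have gens: "(UNIV :: 'r gen set) = insert Gen_a (range Gen_t)"
      proof (rule UNIV_eq_I)
        fix g :: "'r gen"
        show "g \<in> insert Gen_a (range Gen_t)" by (cases g) auto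
      qed
      show ?thesis unfolding gens image_insert image_image ..
    qed
    ultimately show ?thesis
      by (simp add: Gamma_nil_x_def Gamma_nil_s_eq[abs_def] image_image del: lower_central.simps)
  qed

  have "cyclic_by_free_abelian ?Q ?x ?s (\<lambda>i. int (p i ^ y i)) (int (m ^ c)) \<sigma>"
  proof (intro cyclic_by_free_abelian.intro cyclic_by_free_abelian_axioms.intro)
    show "?x [^]\<^bsub>?Q\<^esub> k = \<one>\<^bsub>?Q\<^esub> \<longleftrightarrow> int (m ^ c) dvd k" for k :: int
      using pr.H.int_pow_eq_id[OF x, of k] by (simp add: ord)
    show "int (m ^ c) > 0" using mpos by simp
    show "coprime (int (p i ^ y i)) (int (m ^ c))" for i
      using coprime_power_of_cong_1[OF q_cong[of i], of c] by simp
    show "?s i \<otimes>\<^bsub>?Q\<^esub> ?x \<otimes>\<^bsub>?Q\<^esub> inv\<^bsub>?Q\<^esub> ?s i = ?x [^]\<^bsub>?Q\<^esub> int (p i ^ y i)" for i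
      by (simp only: s_conj int_pow_int)
    show "\<sigma> j (g \<otimes>\<^bsub>?Q\<^esub> h) = \<sigma> j g + \<sigma> j h" if "g \<in> carrier ?Q" "h \<in> carrier ?Q" for g h j
      using hom_mult[OF \<sigma>(1) that] by (simp add: integer_group_def)
    fix s' :: "'r \<Rightarrow> _"
    assume s': "range s' \<subseteq> carrier ?Q" "\<And>i j. s' i \<otimes>\<^bsub>?Q\<^esub> s' j = s' j \<otimes>\<^bsub>?Q\<^esub> s' i"
      "\<And>i. s' i \<otimes>\<^bsub>?Q\<^esub> ?x \<otimes>\<^bsub>?Q\<^esub> inv\<^bsub>?Q\<^esub> s' i = ?x [^]\<^bsub>?Q\<^esub> int (p i ^ y i)"
    have closed: "s' i \<in> carrier ?Q" for i using s'(1) by auto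
    obtain \<phi> where "\<phi> \<in> hom ?Q ?Q" "\<phi> ?x = ?x" "\<And>i. \<phi> (?s i) = s' i"
      by (rule Gamma_nil_universal[where p = p and y = y, OF pr.H.is_group nilpotent x closed
            s'(2) s'(3)[unfolded int_pow_int]]) (rule that)
    then show "\<exists>\<phi>\<in>hom ?Q ?Q. \<phi> ?x = ?x \<and> (\<forall>i. \<phi> (?s i) = s' i)" by auto
  qed (use x s s_comm gen_carrier \<sigma> pr.H.is_group in auto)
  then show ?thesis by blast
qed

theorem mainTheorem4:
  fixes n c m :: nat
    and p y :: "'r::finite \<Rightarrow> nat"
    and M :: "int^'r^'r"
  assumes "\<And>i. prime (p i)"
    and "inj p"
    and "\<And>i. y i > 0"
    and "n = (\<Prod>i\<in>UNIV. p i ^ y i)"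
    and "CARD('r) \<ge> 2"
    and "m = Gcd (range (\<lambda>i. p i ^ y i - 1))"
    and "c \<ge> 1"
    and "invertible M"
  shows "(\<exists>\<phi> \<in> iso (Gamma_nil p y c) (Gamma_nil p y c). induces_matrix p y c \<phi> M) \<longleftrightarrow>
    (\<forall>i. [(\<Prod>j\<in>UNIV. mod_powi (int (m ^ c)) (int (p j ^ y j)) (M $ j $ i)) = int (p i ^ y i)]
      (mod int (m ^ c)))"
proof -
  have "p i ^ y i > 1" for i
    using assms(1,3) by (intro one_less_power prime_gt_1_nat)
  then obtain \<sigma> where "cyclic_by_free_abelian (Gamma_nil p y c) (Gamma_nil_x p y c) (Gamma_nil_s p y c)
      (\<lambda>i. int (p i ^ y i)) (int (m ^ c)) \<sigma>"
    using Gamma_nil_cyclic_by_free_abelian[of p y m c] assms(6,7) by blast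
  from cyclic_by_free_abelian.matrix_realizable_iff[OF this \<open>invertible M\<close>]
  show ?thesis by (simp only: induces_matrix_def Let_def)
qed

end
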